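(* There exist pairwise topologically conjugate continuous maps $P,S,T\colon[0,1]\to[0,1]$, sets $K,L,M\subset[0,1]$ and positive numbers $\delta_d$ ($d\ge2$) such that: (1) $K,L,M$ have full Lebesgue measure; (2) for every $d\ge2$, every $d$-tuple of pairwise distinct points of $L$ is $\delta_d$-Li-Yorke for $S$, and every $d$-tuple of pairwise distinct points of $M$ is $\delta_d$-Li-Yorke for $T$; (3) $\omega(x,S)=[0,1]$ for every $x\in L$; (4) there is a Cantor set $A$ of positive Lebesgue measure which is a minimal set for $T$ such that $\omega(x,T)=A$ for every $x\in M$; (5) no pair $(x,y)\in K\times K$ is Li-Yorke for $P$; in particular the set of Li-Yorke pairs of $P$ has zero two-dimensional Lebesgue measure.
   Context: For a continuous map $f$ on $[0,1]$ with metric $\rho(x,y)=|x-y|$, a $d$-tuple $(x_1,\dots,x_d)$ is proximal if $\liminf_n\max_{i,j}\rho(f^n x_i,f^n x_j)=0$, $\delta$-separated if $\limsup_n\min_{i\ne j}\rho(f^n x_i,f^n x_j)>\delta$, Li-Yorke if proximal and $\delta$-separated for some $\delta>0$, and $\delta$-Li-Yorke if proximal and $\delta$-separated. $\omega(x,f)$ is the $\omega$-limit set of $x$. A minimal set is a nonempty closed invariant set with no proper nonempty closed invariant subset. *)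

theory Defs
  imports "HOL-Analysis.Analysis" "HOL-Library.Liminf_Limsup"
begin

definition interval_map :: "(real \<Rightarrow> real) \<Rightarrow> bool" where
  "interval_map f \<longleftrightarrow> continuous_on {0..1} f \<and> f ` {0..1} \<subseteq> {0..1}"

definition top_conjugate :: "(real \<Rightarrow> real) \<Rightarrow> (real \<Rightarrow> real) \<Rightarrow> bool" where
  "top_conjugate f g \<longleftrightarrow> (\<exists>h h'. homeomorphism {0..1} {0..1} h h' \<and>
      (\<forall>x\<in>{0..1::real}. h (f x) = g (h x)))"

definition proximal :: "(real \<Rightarrow> real) \<Rightarrow> nat \<Rightarrow> (nat \<Rightarrow> real) \<Rightarrow> bool" where
  "proximal f d x \<longleftrightarrow>
     liminf (\<lambda>n. ereal (Max {\<bar>(f^^n) (x i) - (f^^n) (x j)\<bar> | i j. i < d \<and> j < d})) = 0"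

definition separated :: "(real \<Rightarrow> real) \<Rightarrow> real \<Rightarrow> nat \<Rightarrow> (nat \<Rightarrow> real) \<Rightarrow> bool" where
  "separated f \<delta> d x \<longleftrightarrow>
     limsup (\<lambda>n. ereal (Min {\<bar>(f^^n) (x i) - (f^^n) (x j)\<bar> | i j. i < d \<and> j < d \<and> i \<noteq> j}))
       > ereal \<delta>"

definition delta_li_yorke :: "(real \<Rightarrow> real) \<Rightarrow> real \<Rightarrow> nat \<Rightarrow> (nat \<Rightarrow> real) \<Rightarrow> bool" where
  "delta_li_yorke f \<delta> d x \<longleftrightarrow> proximal f d x \<and> separated f \<delta> d x"

definition li_yorke :: "(real \<Rightarrow> real) \<Rightarrow> nat \<Rightarrow> (nat \<Rightarrow> real) \<Rightarrow> bool" where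
  "li_yorke f d x \<longleftrightarrow> (\<exists>\<delta>>0. delta_li_yorke f \<delta> d x)"

definition li_yorke_pair :: "(real \<Rightarrow> real) \<Rightarrow> real \<Rightarrow> real \<Rightarrow> bool" where
  "li_yorke_pair f a b \<longleftrightarrow> li_yorke f 2 (\<lambda>i. if i = 0 then a else b)"

definition omega_limit :: "real \<Rightarrow> (real \<Rightarrow> real) \<Rightarrow> real set" where
  "omega_limit x f = {y. \<exists>r. strict_mono r \<and> (\<lambda>n. (f^^(r n)) x) \<longlonglongrightarrow> y}"

definition minimal_set :: "(real \<Rightarrow> real) \<Rightarrow> real set \<Rightarrow> bool" where
  "minimal_set f A \<longleftrightarrow> A \<noteq> {} \<and> closed A \<and> A \<subseteq> {0..1} \<and> f ` A \<subseteq> A \<and>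
     (\<forall>B. B \<noteq> {} \<and> closed B \<and> B \<subseteq> A \<and> f ` B \<subseteq> B \<longrightarrow> B = A)"

definition cantor_set :: "real set \<Rightarrow> bool" where
  "cantor_set A \<longleftrightarrow> A \<noteq> {} \<and> compact A \<and> (\<forall>x\<in>A. x islimpt A) \<and>
     (\<forall>x\<in>A. connected_component_set A x = {x})"

definition full_measure :: "real set \<Rightarrow> bool" where
  "full_measure K \<longleftrightarrow> K \<subseteq> {0..1} \<and> {0..1} - K \<in> null_sets lebesgue"

end

theory Submission
  imports Defs "HOL-Probability.Probability" "HOL-Library.Discrete_Functions"
begin

text \<open>All three maps are conjugates \<open>h \<circ> tent \<circ> h\<^sup>-\<^sup>1\<close> of the full tent map. If \<open>\<Phi>\<close> is an injective
  Borel map from the Cantor space of coin tosses to \<open>[0,1]\<close> whose distribution charges every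
  interval, then the distribution function \<open>h\<close> of \<open>\<Phi>\<close> is a homeomorphism of \<open>[0,1]\<close> carrying the
  range of \<open>\<Phi>\<close> to a set of full Lebesgue measure. So only uncountable families of points with
  prescribed tent dynamics are needed; they are given by binary expansions: first an arbitrary
  finite word, which makes the family meet every interval, then a sequence depending on the
  parameter \<open>z\<close>.

  For \<open>S\<close> and \<open>T\<close> the block of positions from \<open>2 ^ m\<close> to \<open>2 ^ (m + 1)\<close> repeats the beginning of a
  sequence determined by \<open>rl m z\<close>, where the rules \<open>rl m\<close> run infinitely often through all maps
  that look up a finite prefix of \<open>z\<close> in a table. Constant rules give proximality (and density of
  orbits, or minimality), and rules telling \<open>d\<close> given prefixes apart give separation by a constant
  that depends only on \<open>d\<close>. For \<open>S\<close> the value of the rule is copied literally; for \<open>T\<close> the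
  construction is applied to it recursively, which makes all sequences uniformly recurrent in the
  same way. For \<open>P\<close> the parameter is spread out as a Toeplitz sequence: parameters that differ in
  one digit give sequences that differ with bounded gaps, and no two points are proximal.\<close>

subsection \<open>The tent map and binary expansions\<close>

definition tent :: "real \<Rightarrow> real" where
  "tent x = 1 - \<bar>1 - 2 * x\<bar>"

lemma tent_lipschitz: "\<bar>tent x - tent y\<bar> \<le> 2 * \<bar>x - y\<bar>"
  unfolding tent_def by (simp add: abs_if)

lemma tent_in: "x \<in> {0..1} \<Longrightarrow> tent x \<in> {0..1}"
  unfolding tent_def by (auto simp: abs_if)

lemma tent_pow_in: "x \<in> {0..1} \<Longrightarrow> (tent ^^ n) x \<in> {0..1}"
  by (induction n) (use tent_in in auto)

lemma tent_pow_lipschitz: "\<bar>(tent ^^ n) x - (tent ^^ n) y\<bar> \<le> 2 ^ n * \<bar>x - y\<bar>"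
proof (induction n)
  case (Suc n)
  show ?case using tent_lipschitz[of "(tent ^^ n) x" "(tent ^^ n) y"] Suc by simp
qed simp

lemma continuous_on_tent: "continuous_on S tent"
  unfolding tent_def by (intro continuous_intros)

definition bin :: "(nat \<Rightarrow> bool) \<Rightarrow> real" where
  "bin s = (\<Sum>i. of_bool (s i) * (1/2) ^ Suc i)"

lemma summable_bin: "summable (\<lambda>i. of_bool (s i) * (1/2::real) ^ Suc i)"
proof (rule summable_comparison_test)
  show "\<exists>N. \<forall>n\<ge>N. norm (of_bool (s n) * (1/2::real) ^ Suc n) \<le> (1/2) ^ Suc n" by auto
  show "summable (\<lambda>n. (1/2::real) ^ Suc n)" using power_half_series by (rule sums_summable)
qed

lemma bin_in: "bin s \<in> {0..1}"
proof -
  have "0 \<le> bin s" unfolding bin_def by (rule suminf_nonneg[OF summable_bin]) simp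
  moreover have "bin s \<le> (\<Sum>i. (1/2::real) ^ Suc i)" unfolding bin_def
    by (rule suminf_le[OF _ summable_bin]) (use power_half_series in \<open>auto intro: sums_summable\<close>)
  moreover have "(\<Sum>i. (1/2::real) ^ Suc i) = 1" using power_half_series sums_unique by metis
  ultimately show ?thesis by simp
qed

lemma bin_rec: "bin s = of_bool (s 0) / 2 + bin (\<lambda>i. s (Suc i)) / 2"
proof -
  have "(\<Sum>i. of_bool (s (Suc i)) * (1/2) ^ Suc (Suc i)) =
      (\<Sum>i. (1/2) * (of_bool (s (Suc i)) * (1/2::real) ^ Suc i))" by (simp add: field_simps)
  also have "\<dots> = (1/2) * bin (\<lambda>i. s (Suc i))" unfolding bin_def
    using suminf_mult[OF summable_bin, of "1/2" "\<lambda>i. s (Suc i)"] by simp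
  finally show ?thesis
    unfolding bin_def using suminf_split_head[OF summable_bin, of s] by simp
qed

lemma bin_agree:
  assumes "\<And>i. i < k \<Longrightarrow> s i = t i"
  shows "\<bar>bin s - bin t\<bar> \<le> (1/2) ^ k"
  using assms
proof (induction k arbitrary: s t)
  case 0
  then show ?case using bin_in[of s] bin_in[of t] by (auto simp: abs_if)
next
  case (Suc k)
  have "\<bar>bin (\<lambda>i. s (Suc i)) - bin (\<lambda>i. t (Suc i))\<bar> \<le> (1/2) ^ k"
    by (rule Suc.IH) (use Suc.prems in auto)
  moreover have "s 0 = t 0" using Suc.prems by simp
  ultimately show ?case using bin_rec[of s] bin_rec[of t] by (simp add: diff_divide_distrib[symmetric])
qed

text \<open>Passing from \<open>2 ^ n * x\<close> to twice that number turns the floor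
  \<open>a\<close> into \<open>2 * a\<close> or \<open>2 * a + 1\<close>, and the parity of the new
  floor records which. So the partial sums are the dyadic truncations of \<open>x\<close>.\<close>

lemma bin_partial:
  fixes x :: real
  assumes "0 \<le> x" "x < 1"
  shows "(\<Sum>i<n. of_bool (odd \<lfloor>2 ^ Suc i * x\<rfloor>) * (1/2::real) ^ Suc i) = of_int \<lfloor>2 ^ n * x\<rfloor> / 2 ^ n"
proof (induction n)
  case 0
  have "\<lfloor>x\<rfloor> = 0" using assms by (simp add: floor_eq_iff)
  then show ?case by simp
next
  case (Suc n)
  define a where "a = \<lfloor>2 ^ n * x\<rfloor>"
  define b where "b = \<lfloor>2 ^ Suc n * x\<rfloor>"
  have a: "of_int a \<le> 2 ^ n * x" "2 ^ n * x < of_int a + 1" unfolding a_def by linarith+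
  have b: "of_int b \<le> 2 * (2 ^ n * x)" "2 * (2 ^ n * x) < of_int b + 1"
    unfolding b_def power_Suc by linarith+
  have "b = 2 * a \<or> b = 2 * a + 1" using a b by linarith
  then have e: "real_of_int b = 2 * of_int a + of_bool (odd b)" by auto
  have "(\<Sum>i<Suc n. of_bool (odd \<lfloor>2 ^ Suc i * x\<rfloor>) * (1/2::real) ^ Suc i)
      = of_int a / 2 ^ n + of_bool (odd b) * (1/2) ^ Suc n"
    using Suc by (simp add: a_def b_def)
  also have "\<dots> = of_int b / 2 ^ Suc n" unfolding e by (simp add: field_simps power_one_over)
  finally show ?case by (simp add: b_def)
qed

lemma bin_surj:
  fixes x :: real
  assumes "0 \<le> x" "x < 1"
  shows "\<exists>s. bin s = x"
proof -
  define s where "s i = odd \<lfloor>2 ^ Suc i * x\<rfloor>" for i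
  have "(\<lambda>n. of_int \<lfloor>2 ^ n * x\<rfloor> / 2 ^ n) \<longlonglongrightarrow> x"
  proof (rule LIMSEQ_I)
    fix e :: real assume "e > 0"
    then obtain N where N: "(1/2) ^ N < e" using real_arch_pow_inv[of e "1/2"] by auto
    have "norm (of_int \<lfloor>2 ^ n * x\<rfloor> / 2 ^ n - x) < e" if "n \<ge> N" for n
    proof -
      define y where "y = 2 ^ n * x"
      have "x = y / 2 ^ n" by (simp add: y_def)
      then have "of_int \<lfloor>y\<rfloor> / 2 ^ n - x = (of_int \<lfloor>y\<rfloor> - y) * (1/2) ^ n"
        by (simp add: power_one_over diff_divide_distrib)
      then have "\<bar>of_int \<lfloor>y\<rfloor> / 2 ^ n - x\<bar> = \<bar>of_int \<lfloor>y\<rfloor> - y\<bar> * (1/2) ^ n"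
        by (simp add: abs_mult)
      also have "\<dots> \<le> 1 * (1/2) ^ n" by (rule mult_right_mono) (linarith, simp)
      finally have "\<bar>of_int \<lfloor>y\<rfloor> / 2 ^ n - x\<bar> \<le> (1/2) ^ n" by simp
      moreover have "(1/2) ^ n \<le> (1/2::real) ^ N" using that by (intro power_decreasing) auto
      ultimately show ?thesis using N unfolding y_def real_norm_def by linarith
    qed
    then show "\<exists>no. \<forall>n\<ge>no. norm (of_int \<lfloor>2 ^ n * x\<rfloor> / 2 ^ n - x) < e" by blast
  qed
  then have "(\<lambda>i. of_bool (s i) * (1/2::real) ^ Suc i) sums x"
    unfolding sums_def s_def bin_partial[OF assms] .
  then show ?thesis unfolding bin_def using sums_unique by blast
qed

text \<open>\<open>tent\<close> composed with itself equals \<open>tent\<close> after doubling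
  modulo 1. Coding points by \<open>tent (bin s)\<close> instead of \<open>bin s\<close> therefore
  makes the tent map act as the shift.\<close>

definition pt :: "(nat \<Rightarrow> bool) \<Rightarrow> real" where
  "pt s = tent (bin s)"

lemma pt_in: "pt s \<in> {0..1}"
  unfolding pt_def by (rule tent_in[OF bin_in])

lemma pt_rec: "pt s = (if s 0 then 1 - bin (\<lambda>i. s (Suc i)) else bin (\<lambda>i. s (Suc i)))"
  using bin_rec[of s] bin_in[of "\<lambda>i. s (Suc i)"] unfolding pt_def tent_def by (auto simp: abs_if)

text \<open>The first digit only chooses between the value of the shifted expansion and its mirror
  image about 1/2, and \<open>tent\<close> identifies these two.\<close>

lemma tent_pt: "tent (pt s) = pt (\<lambda>i. s (Suc i))"
  unfolding pt_rec[of s] by (auto simp: pt_def tent_def abs_if)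

lemma tent_pow_pt: "(tent ^^ n) (pt s) = pt (\<lambda>i. s (n + i))"
  by (induction n) (auto simp: tent_pt)

lemma pt_agree:
  assumes "\<And>i. i < k \<Longrightarrow> s i = t i"
  shows "\<bar>pt s - pt t\<bar> \<le> 2 * (1/2) ^ k"
proof -
  have "\<bar>bin s - bin t\<bar> \<le> (1/2) ^ k" using assms by (rule bin_agree)
  then have "2 * \<bar>bin s - bin t\<bar> \<le> 2 * (1/2) ^ k" by simp
  then show ?thesis using tent_lipschitz[of "bin s" "bin t"] unfolding pt_def by (rule order.trans[rotated])
qed

lemma pt_agree_less:
  assumes "e > 0"
  obtains k where "\<And>s t. (\<And>i. i < k \<Longrightarrow> s i = t i) \<Longrightarrow> \<bar>pt s - pt t\<bar> < e"
proof -
  obtain k where "(1/2) ^ k < e / 2" using real_arch_pow_inv[of "e/2" "1/2"] assms by auto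
  then have "2 * (1/2) ^ k < e" by simp
  then have "\<bar>pt s - pt t\<bar> < e" if "\<And>i. i < k \<Longrightarrow> s i = t i" for s t
    using pt_agree[OF that] by (rule order.strict_trans1[rotated])
  then show ?thesis by (rule that)
qed

lemma pt_surj:
  assumes "0 \<le> x" "x \<le> 1"
  shows "\<exists>s. pt s = x"
proof -
  \<comment> \<open>\<open>tent\<close> doubles on the left half of the interval, and
    \<open>x / 2 < 1\<close> holds even for \<open>x = 1\<close>, the value that
    \<open>bin_surj\<close> leaves out.\<close>
  obtain s where "bin s = x / 2" using bin_surj[of "x/2"] assms by auto
  then show ?thesis using assms by (auto intro!: exI[of _ s] simp: pt_def tent_def)
qed

text \<open>Sequences vanishing at even positions avoid both the fold of the tent map and the
  ambiguity of dyadic expansions.\<close>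

lemma pt_spread_diff:
  assumes "\<And>i. even i \<Longrightarrow> \<not> s i" "\<And>i. even i \<Longrightarrow> \<not> t i" "s 1 \<noteq> t 1"
  shows "\<bar>pt s - pt t\<bar> \<ge> 1/4"
proof -
  \<comment> \<open>Digit 0 selects the unfolded branch and digit 2 confines the tail to [0, 1/4],
    so a change of digit 1 by 1/2 leaves a gap of at least 1/4.\<close>
  have *: "pt u = of_bool (u 1) / 2 + bin (\<lambda>i. u (i + 3)) / 4" if "\<And>i. even i \<Longrightarrow> \<not> u i" for u
    using that[of 0] that[of 2] bin_rec[of "\<lambda>i. u (Suc i)"] bin_rec[of "\<lambda>i. u (Suc (Suc i))"]
    by (simp add: pt_rec[of u] numeral_3_eq_3 numeral_2_eq_2)
  show ?thesis
    using *[OF assms(1)] *[OF assms(2)] assms(3) bin_in[of "\<lambda>i. s (i + 3)"] bin_in[of "\<lambda>i. t (i + 3)"]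
    by (cases "s 1"; cases "t 1") auto
qed

lemma pt_spread_inj:
  assumes s: "\<And>i. even i \<Longrightarrow> \<not> s i" and t: "\<And>i. even i \<Longrightarrow> \<not> t i" and "s \<noteq> t"
  shows "pt s \<noteq> pt t"
proof
  assume eq: "pt s = pt t"
  obtain n where n: "s n \<noteq> t n" using \<open>s \<noteq> t\<close> by auto
  then have "odd n" using s t by blast
  then obtain k where k: "n = 2 * k + 1" by (auto elim: oddE)
  \<comment> \<open>An even shift brings the differing digit to index 1 and keeps the even indices
    \<open>False\<close>.\<close>
  have "\<bar>pt (\<lambda>i. s (2 * k + i)) - pt (\<lambda>i. t (2 * k + i))\<bar> \<ge> 1/4"
    by (rule pt_spread_diff) (use s t n k in auto)
  then show False using eq tent_pow_pt[of "2 * k" s] tent_pow_pt[of "2 * k" t] by simp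
qed

subsection \<open>Block sequences\<close>

definition pad :: "bool list \<Rightarrow> nat \<Rightarrow> bool" where
  "pad w i \<longleftrightarrow> i < length w \<and> w ! i"

definition override :: "bool list \<Rightarrow> (nat \<Rightarrow> bool) \<Rightarrow> nat \<Rightarrow> bool" where
  "override w s i = (if i < length w then w ! i else s i)"

text \<open>The natural number \<open>m\<close> codes a finite table that maps words of a fixed length \<open>k\<close> to words;
  the first component of the code is a dummy that makes every table recur infinitely often.\<close>

definition rule_len :: "nat \<Rightarrow> nat" where
  "rule_len m = fst (snd (from_nat m :: nat \<times> nat \<times> (bool list \<times> bool list) list))"

definition rule_tab :: "nat \<Rightarrow> (bool list \<times> bool list) list" where
  "rule_tab m = snd (snd (from_nat m :: nat \<times> nat \<times> (bool list \<times> bool list) list))"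

definition rl :: "nat \<Rightarrow> (nat \<Rightarrow> bool) \<Rightarrow> nat \<Rightarrow> bool" where
  "rl m z = pad (case map_of (rule_tab m) (map z [0..<rule_len m]) of None \<Rightarrow> [] | Some w \<Rightarrow> w)"

lemma rule_recurs:
  obtains m where "m \<ge> N" "rule_len m = k" "rule_tab m = tab"
proof -
  define g where "g j = to_nat (j :: nat, k, tab)" for j
  have "inj g" unfolding g_def inj_def by simp
  then have "infinite (range g)" using finite_imageD by blast
  then obtain m where "m \<in> range g" "m \<ge> N" unfolding infinite_nat_iff_unbounded_le by blast
  then show ?thesis using that unfolding rule_len_def rule_tab_def g_def by auto
qed

lemma rl_const:
  obtains m where "m \<ge> N" "\<And>z. rl m z = pad w"
proof -
  obtain m where "m \<ge> N" "rule_len m = 0" "rule_tab m = [([], w)]" by (rule rule_recurs)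
  then show ?thesis using that[of m] unfolding rl_def by simp
qed

lemma prefixes_distinct:
  assumes "inj_on z {..<d::nat}"
  obtains k where "inj_on (\<lambda>i. map (z i) [0..<k]) {..<d}"
proof -
  have "\<exists>n. z i n \<noteq> z j n" if "i < d" "j < d" "i \<noteq> j" for i j
    using assms that unfolding inj_on_def by (metis ext lessThan_iff)
  then obtain n where n: "\<And>i j. i < d \<Longrightarrow> j < d \<Longrightarrow> i \<noteq> j \<Longrightarrow> z i (n i j) \<noteq> z j (n i j)"
    by metis
  define k where "k = Suc (Max ((\<lambda>(i, j). n i j) ` ({..<d} \<times> {..<d})))"
  have k: "n i j < k" if "i < d" "j < d" for i j
  proof -
    have "n i j \<le> Max ((\<lambda>(i, j). n i j) ` ({..<d} \<times> {..<d}))"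
      by (rule Max_ge) (use that in auto)
    then show ?thesis unfolding k_def by simp
  qed
  have "inj_on (\<lambda>i. map (z i) [0..<k]) {..<d}"
  proof (rule inj_onI, rule ccontr)
    fix i j assume a: "i \<in> {..<d}" "j \<in> {..<d}" "map (z i) [0..<k] = map (z j) [0..<k]" "i \<noteq> j"
    have "map (z i) [0..<k] ! n i j = map (z j) [0..<k] ! n i j" by (simp only: a(3))
    then show False using n[of i j] k[of i j] a by simp
  qed
  then show ?thesis by (rule that)
qed

text \<open>Sufficiently long prefixes of distinct parameters are distinct, so they can be the keys
  of a table with arbitrary entries \<open>w i\<close>. These rules place prescribed words in the
  blocks of \<open>d\<close> given parameters simultaneously.\<close>

lemma rl_table:
  assumes "inj_on z {..<d::nat}"
  obtains m where "m \<ge> N" "\<And>i. i < d \<Longrightarrow> rl m (z i) = pad (w i)"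
proof -
  obtain k where k: "inj_on (\<lambda>i. map (z i) [0..<k]) {..<d}" using prefixes_distinct[OF assms] .
  define tab where "tab = map (\<lambda>i. (map (z i) [0..<k], w i)) [0..<d]"
  obtain m where m: "m \<ge> N" "rule_len m = k" "rule_tab m = tab" by (rule rule_recurs)
  have "map fst tab = map (\<lambda>i. map (z i) [0..<k]) [0..<d]" unfolding tab_def by simp
  then have "distinct (map fst tab)" using k by (simp add: distinct_map lessThan_atLeast0)
  moreover have "(map (z i) [0..<k], w i) \<in> set tab" if "i < d" for i
    using that unfolding tab_def by auto
  ultimately have "map_of tab (map (z i) [0..<k]) = Some (w i)" if "i < d" for i
    using that by (simp add: map_of_is_SomeI)
  then show ?thesis using that[of m] m unfolding rl_def by simp
qed

lemma rl_agree:
  assumes "\<And>i. i < rule_len m \<Longrightarrow> z i = z' i"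
  shows "rl m z = rl m z'"
proof -
  have "map z [0..<rule_len m] = map z' [0..<rule_len m]" using assms by simp
  then show ?thesis unfolding rl_def by (simp only:)
qed

text \<open>The continuous maps of Cantor space, stated without topology.\<close>

definition finitary :: "((nat \<Rightarrow> bool) \<Rightarrow> nat \<Rightarrow> bool) \<Rightarrow> bool" where
  "finitary F \<longleftrightarrow> (\<forall>n. \<exists>k. \<forall>z z'. (\<forall>i<k. z i = z' i) \<longrightarrow> F z n = F z' n)"

lemma finitary_prefix:
  assumes "finitary F"
  shows "\<exists>k. \<forall>z z'. (\<forall>i<k. z i = z' i) \<longrightarrow> (\<forall>i<n. F z i = F z' i)"
proof -
  obtain k where k: "\<And>n z z'. (\<forall>i<k n. z i = z' i) \<Longrightarrow> F z n = F z' n"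
    using assms unfolding finitary_def by metis
  define K where "K = Max (insert 0 (k ` {..<n}))"
  have "k i \<le> K" if "i < n" for i unfolding K_def by (rule Max_ge) (use that in auto)
  then have "F z i = F z' i" if "\<forall>i<K. z i = z' i" "i < n" for z z' i
    using that by (intro k) (meson less_le_trans)
  then show ?thesis by blast
qed

text \<open>The common shape of \<open>dense_seq\<close>, where \<open>G\<close> is the identity,
  and of \<open>min_seq\<close>, where \<open>G\<close> is \<open>min_seq\<close> itself.
  Proximality and separation are derived from it once for both.\<close>

definition block_map :: "((nat \<Rightarrow> bool) \<Rightarrow> nat \<Rightarrow> bool) \<Rightarrow> ((nat \<Rightarrow> bool) \<Rightarrow> nat \<Rightarrow> bool) \<Rightarrow> bool" where
  "block_map F G \<longleftrightarrow> (\<forall>m z i. 1 \<le> m \<longrightarrow> i < 2 ^ m \<longrightarrow> F z (2 ^ m + i) = G (rl m z) i)"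

lemma floor_log_block: "i < 2 ^ m \<Longrightarrow> floor_log (2 ^ m + i) = m"
  by (rule floor_log_eqI) auto

lemma block_decomp:
  fixes n :: nat
  assumes "n \<ge> 2"
  obtains m i where "1 \<le> m" "i < 2 ^ m" "n = 2 ^ m + i"
proof -
  have *: "2 ^ floor_log n \<le> n" "n < 2 * 2 ^ floor_log n"
    using floor_log_exp2_le[of n] floor_log_exp2_gt[of n] assms by auto
  have "floor_log n \<noteq> 0" using * assms by (intro notI) simp
  then show ?thesis using * that[of "floor_log n" "n - 2 ^ floor_log n"] by simp
qed

definition dense_seq :: "(nat \<Rightarrow> bool) \<Rightarrow> nat \<Rightarrow> bool" where
  "dense_seq z n = (if n < 2 then False else rl (floor_log n) z (n - 2 ^ floor_log n))"

lemma block_map_dense_seq: "block_map dense_seq (\<lambda>s. s)"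
proof -
  have "(2::nat) \<le> 2 ^ m" if "1 \<le> m" for m using power_increasing[of 1 m "2::nat"] that by simp
  then have "\<not> 2 ^ m + i < (2::nat)" if "1 \<le> m" for m i using that by (meson le_add1 le_trans not_le)
  then show ?thesis unfolding block_map_def dense_seq_def by (simp add: floor_log_block)
qed

lemma finitary_dense_seq: "finitary dense_seq"
  unfolding finitary_def dense_seq_def using rl_agree by metis

text \<open>Positions 0 and 1 are seeds, and only the second one shows the parameter. Each later
  block begins another sequence of the same family, with the finitely supported parameter
  \<open>rl m z\<close>; this self-similarity is the source of minimality.\<close>

function min_seq :: "(nat \<Rightarrow> bool) \<Rightarrow> nat \<Rightarrow> bool" where
  "min_seq z n = (if n < 2 then n = 1 \<and> z 0
     else min_seq (rl (floor_log n) z) (n - 2 ^ floor_log n))"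
  by pat_completeness auto
termination by (relation "Wellfounded.measure snd") auto

declare min_seq.simps [simp del]

lemma min_seq_0 [simp]: "\<not> min_seq z 0" and min_seq_1 [simp]: "min_seq z (Suc 0) = z 0"
  by (simp_all add: min_seq.simps)

lemma block_map_min_seq: "block_map min_seq min_seq"
proof -
  have "(2::nat) \<le> 2 ^ m" if "1 \<le> m" for m using power_increasing[of 1 m "2::nat"] that by simp
  then have "\<not> 2 ^ m + i < (2::nat)" if "1 \<le> m" for m i using that by (meson le_add1 le_trans not_le)
  then show ?thesis unfolding block_map_def
    by (subst min_seq.simps) (simp add: floor_log_block)
qed

lemma min_seq_block: "1 \<le> m \<Longrightarrow> i < 2 ^ m \<Longrightarrow> min_seq z (2 ^ m + i) = min_seq (rl m z) i"
  using block_map_min_seq unfolding block_map_def by blast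

lemma finitary_min_seq: "finitary min_seq"
  unfolding finitary_def
proof
  fix n
  show "\<exists>k. \<forall>z z'. (\<forall>i<k. z i = z' i) \<longrightarrow> min_seq z n = min_seq z' n"
  proof (cases "n < 2")
    case True
    then show ?thesis by (intro exI[of _ 1]) (auto simp: min_seq.simps)
  next
    case False
    then show ?thesis by (subst (1 2) min_seq.simps) (use rl_agree in \<open>metis\<close>)
  qed
qed

text \<open>Blocks start at \<open>2 ^ m\<close> with \<open>m \<ge> 1\<close>, so the recursion
  preserves parity and ends at the seed \<open>False\<close> in position 0.\<close>

lemma min_seq_even: "even n \<Longrightarrow> \<not> min_seq z n"
proof (induction n arbitrary: z rule: less_induct)
  case (less n)
  show ?case
  proof (cases "n \<ge> 2")
    case True
    then obtain m i where m: "1 \<le> m" "i < 2 ^ m" "n = 2 ^ m + i" by (rule block_decomp)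
    then have "even i" "i < n" using less.prems by auto
    then show ?thesis using less.IH m by (simp add: min_seq_block)
  next
    case False
    then have "n = 0 \<or> n = 1" by linarith
    then have "n = 0" using less.prems by auto
    then show ?thesis by simp
  qed
qed

text \<open>Some rule gives the word \<open>[True]\<close> to one parameter and the empty word to
  the other; index 1 of the corresponding block shows the first letter of that word.\<close>

lemma min_seq_inj: "inj min_seq"
proof (rule injI, rule ccontr)
  fix z z' assume eq: "min_seq z = min_seq z'" and ne: "z \<noteq> z'"
  define u where "u i = (if i = 0 then z else z')" for i :: nat
  have "inj_on u {..<2}" using ne by (auto simp: inj_on_def u_def)
  then obtain m where m: "m \<ge> 1" "\<And>i. i < 2 \<Longrightarrow> rl m (u i) = pad (if i = 0 then [True] else [])"
    using rl_table[of u 2 1 "\<lambda>i. if i = 0 then [True] else []"] by blast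
  have "rl m z = pad [True]" "rl m z' = pad []" using m(2)[of 0] m(2)[of 1] by (auto simp: u_def)
  moreover have "(1::nat) < 2 ^ m" using m(1) by (intro one_less_power) auto
  ultimately have "min_seq z (2 ^ m + 1)" "\<not> min_seq z' (2 ^ m + 1)"
    using m(1) min_seq_block[of m 1] by (simp_all add: pad_def)
  then show False using eq by simp
qed

text \<open>The blocks of length \<open>2 ^ m\<close> of a sequence \<open>min_seq z\<close> are prefixes of such sequences,
  so every prefix that occurs somewhere reappears with bounded gaps.\<close>

lemma min_seq_aligned_block:
  assumes "1 \<le> m"
  shows "\<exists>z'. \<forall>i<2 ^ m. min_seq z (q * 2 ^ m + i) = min_seq z' i"
proof (induction q arbitrary: z rule: less_induct)
  case (less q)
  show ?case
  proof (cases "q = 0")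
    case True
    then show ?thesis by auto
  next
    case False
    \<comment> \<open>Removing the leading binary digit of \<open>q\<close> locates the aligned
      block inside the large block that starts at \<open>2 ^ (p + m)\<close>, where it is aligned
      block number \<open>q'\<close> of a sequence with another parameter.\<close>
    define p where "p = floor_log q"
    have p: "2 ^ p \<le> q" "q < 2 * 2 ^ p"
      using floor_log_exp2_le[of q] floor_log_exp2_gt[of q] False unfolding p_def by auto
    define q' where "q' = q - 2 ^ p"
    have q': "q = 2 ^ p + q'" "q' < 2 ^ p" "q' < q" using p False unfolding q'_def by auto
    obtain z' where z': "\<forall>i<2 ^ m. min_seq (rl (p + m) z) (q' * 2 ^ m + i) = min_seq z' i"
      using less.IH[OF q'(3)] by blast
    have "min_seq z (q * 2 ^ m + i) = min_seq z' i" if "i < 2 ^ m" for i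
    proof -
      have "Suc q' * 2 ^ m \<le> 2 ^ p * 2 ^ m" using q' by (intro mult_right_mono) auto
      then have "q' * 2 ^ m + i < 2 ^ (p + m)" using that by (simp add: power_add)
      moreover have "q * 2 ^ m + i = 2 ^ (p + m) + (q' * 2 ^ m + i)"
        using q' by (simp add: power_add algebra_simps)
      ultimately show ?thesis using min_seq_block[of "p + m" "q' * 2 ^ m + i" z] assms z' that
        by (metis trans_le_add2)
    qed
    then show ?thesis by blast
  qed
qed

subsection \<open>Li--Yorke tuples and distal pairs of the tent map\<close>

text \<open>Quantified forms of the conditions on the lower and upper limits, convenient to carry
  over by uniformly continuous maps. Separation is stated with a weak inequality; the strict one is
  recovered later by shrinking the constant.\<close>

definition prox_tuple :: "(real \<Rightarrow> real) \<Rightarrow> nat \<Rightarrow> (nat \<Rightarrow> real) \<Rightarrow> bool" where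
  "prox_tuple f d x \<longleftrightarrow>
    (\<forall>e>0. \<forall>N. \<exists>n\<ge>N. \<forall>i<d. \<forall>j<d. \<bar>(f ^^ n) (x i) - (f ^^ n) (x j)\<bar> < e)"

definition sep_tuple :: "(real \<Rightarrow> real) \<Rightarrow> real \<Rightarrow> nat \<Rightarrow> (nat \<Rightarrow> real) \<Rightarrow> bool" where
  "sep_tuple f \<delta> d x \<longleftrightarrow>
    (\<forall>N. \<exists>n\<ge>N. \<forall>i<d. \<forall>j<d. i \<noteq> j \<longrightarrow> \<delta> \<le> \<bar>(f ^^ n) (x i) - (f ^^ n) (x j)\<bar>)"

text \<open>The number of leading \<open>True\<close> digits codes the word, so each word is taken
  with positive probability. For the constant sequence \<open>True\<close> no index satisfies the
  \<open>LEAST\<close> condition; that single parameter is treated separately in the measurability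
  arguments.\<close>

definition head_word :: "(nat \<Rightarrow> bool) \<Rightarrow> bool list" where
  "head_word z = from_nat (LEAST i. \<not> z i)"

text \<open>Points of every dyadic interval occur, since \<open>head_word\<close> takes every word as value on an open set.\<close>

definition point :: "((nat \<Rightarrow> bool) \<Rightarrow> nat \<Rightarrow> bool) \<Rightarrow> (nat \<Rightarrow> bool) \<Rightarrow> real" where
  "point F z = pt (override (head_word z) (F z))"

lemma point_in: "point F z \<in> {0..1}"
  unfolding point_def by (rule pt_in)

lemma tent_pow_point:
  "n \<ge> length (head_word z) \<Longrightarrow> (tent ^^ n) (point F z) = pt (\<lambda>i. F z (n + i))"
  unfolding point_def tent_pow_pt by (simp add: override_def)

lemma large_power:
  fixes e :: real and N :: nat
  assumes "e > 0"
  obtains M where "\<And>m. m \<ge> M \<Longrightarrow> 1 \<le> m \<and> N \<le> 2 ^ m \<and> 2 * (1/2) ^ (2 ^ m :: nat) < e"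
proof -
  obtain k where k: "(1/2) ^ k < e / 2" using real_arch_pow_inv[of "e/2" "1/2"] assms by auto
  have "1 \<le> m \<and> N \<le> 2 ^ m \<and> 2 * (1/2) ^ (2 ^ m :: nat) < e" if "m \<ge> Suc (N + k)" for m
  proof -
    have m: "m < 2 ^ m" by (rule less_exp)
    then have "k \<le> 2 ^ m" "N \<le> 2 ^ m" using that by linarith+
    then have "(1/2::real) ^ (2 ^ m :: nat) \<le> (1/2) ^ k" by (intro power_decreasing) auto
    then show ?thesis using k that \<open>N \<le> 2 ^ m\<close> by linarith
  qed
  then show ?thesis by (rule that)
qed

text \<open>At time \<open>2 ^ m\<close> the orbit has left its head word and reads a whole block of
  \<open>2 ^ m\<close> digits, all of them determined by \<open>w\<close>. The bound depends on the
  parameter only through the word \<open>w\<close>.\<close>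

lemma block_map_point:
  assumes "block_map F G" "1 \<le> m" "length (head_word z) \<le> 2 ^ m" "rl m z = pad w"
  shows "\<bar>(tent ^^ (2 ^ m)) (point F z) - pt (G (pad w))\<bar> \<le> 2 * (1/2) ^ (2 ^ m :: nat)"
proof -
  have "F z (2 ^ m + i) = G (pad w) i" if "i < 2 ^ m" for i
    using assms that unfolding block_map_def by metis
  then show ?thesis unfolding tent_pow_point[OF assms(3)] by (intro pt_agree)
qed

lemma block_map_prox:
  assumes "block_map F G"
  shows "prox_tuple tent d (\<lambda>i. point F (z i))"
  unfolding prox_tuple_def
proof (intro allI impI)
  fix e :: real and N assume "e > 0"
  \<comment> \<open>The sum bounds all head words at once, so one time \<open>2 ^ m\<close> serves
    every point of the tuple.\<close>
  define N' where "N' = N + (\<Sum>i<d. length (head_word (z i)))"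
  obtain M where M: "\<And>m. m \<ge> M \<Longrightarrow> 1 \<le> m \<and> N' \<le> 2 ^ m \<and> 2 * (1/2) ^ (2 ^ m :: nat) < e / 2"
    using large_power[of "e/2" N'] \<open>e > 0\<close> by auto
  obtain m where m: "m \<ge> M" "\<And>z. rl m z = pad []" using rl_const[of M "[]"] by blast
  have len: "length (head_word (z i)) \<le> 2 ^ m" if "i < d" for i
    using M[OF m(1)] member_le_sum[of i "{..<d}" "\<lambda>i. length (head_word (z i))"] that
    unfolding N'_def by simp
  have near: "\<bar>(tent ^^ (2 ^ m)) (point F (z i)) - pt (G (pad []))\<bar> < e / 2" if "i < d" for i
    using block_map_point[OF assms _ len[OF that] m(2)] M[OF m(1)] by linarith
  show "\<exists>n\<ge>N. \<forall>i<d. \<forall>j<d. \<bar>(tent ^^ n) (point F (z i)) - (tent ^^ n) (point F (z j))\<bar> < e"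
  proof (intro exI conjI allI impI)
    show "N \<le> 2 ^ m" using M[OF m(1)] unfolding N'_def by linarith
    fix i j assume "i < d" "j < d"
    then show "\<bar>(tent ^^ (2 ^ m)) (point F (z i)) - (tent ^^ (2 ^ m)) (point F (z j))\<bar> < e"
      using near[of i] near[of j] by linarith
  qed
qed

lemma finite_separation:
  fixes v :: "nat \<Rightarrow> real"
  assumes "inj v"
  obtains c where "c > 0" "\<And>i j. i < d \<Longrightarrow> j < d \<Longrightarrow> i \<noteq> j \<Longrightarrow> c \<le> \<bar>v i - v j\<bar>"
proof -
  define S where "S = insert 1 ((\<lambda>(i, j). \<bar>v i - v j\<bar>) ` {(i, j). i < d \<and> j < d \<and> i \<noteq> j})"
  have "finite {(i, j). i < d \<and> j < d \<and> i \<noteq> j}"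
    by (rule finite_subset[of _ "{..<d} \<times> {..<d}"]) auto
  then have S: "finite S" "S \<noteq> {}" unfolding S_def by auto
  have "\<forall>x\<in>S. 0 < x" unfolding S_def using assms by (auto simp: inj_def)
  then have "Min S > 0" using Min_in[OF S] by blast
  moreover have "Min S \<le> \<bar>v i - v j\<bar>" if "i < d" "j < d" "i \<noteq> j" for i j
    by (rule Min_le[OF S(1)]) (use that in \<open>auto simp: S_def\<close>)
  ultimately show ?thesis by (rule that)
qed

text \<open>The words \<open>u i\<close> are fixed before the parameters, so the least distance
  \<open>c\<close> between the target values depends on \<open>d\<close> alone. Two approximation
  errors below \<open>c / 4\<close> still leave \<open>c / 2\<close>.\<close>

lemma block_map_sep:
  assumes "block_map F G" and "inj (\<lambda>n::nat. pt (G (pad (u n))))"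
  shows "\<exists>\<delta>>0. \<forall>z. inj_on z {..<d} \<longrightarrow> sep_tuple tent \<delta> d (\<lambda>i. point F (z i))"
proof -
  obtain c where c: "c > 0" "\<And>i j. i < d \<Longrightarrow> j < d \<Longrightarrow> i \<noteq> j \<Longrightarrow>
      c \<le> \<bar>pt (G (pad (u i))) - pt (G (pad (u j)))\<bar>"
    using finite_separation[OF assms(2)] by metis
  have "sep_tuple tent (c / 2) d (\<lambda>i. point F (z i))" if z: "inj_on z {..<d}" for z
    unfolding sep_tuple_def
  proof
    fix N
    define N' where "N' = N + (\<Sum>i<d. length (head_word (z i)))"
    obtain M where M: "\<And>m. m \<ge> M \<Longrightarrow> 1 \<le> m \<and> N' \<le> 2 ^ m \<and> 2 * (1/2) ^ (2 ^ m :: nat) < c / 4"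
      using large_power[of "c/4" N'] c(1) by auto
    obtain m where m: "m \<ge> M" "\<And>i. i < d \<Longrightarrow> rl m (z i) = pad (u i)"
      using rl_table[OF z, of M u] by blast
    have len: "length (head_word (z i)) \<le> 2 ^ m" if "i < d" for i
      using M[OF m(1)] member_le_sum[of i "{..<d}" "\<lambda>i. length (head_word (z i))"] that
      unfolding N'_def by simp
    have near: "\<bar>(tent ^^ (2 ^ m)) (point F (z i)) - pt (G (pad (u i)))\<bar> < c / 4" if "i < d" for i
      using block_map_point[OF assms(1) _ len[OF that] m(2)[OF that]] M[OF m(1)] by linarith
    show "\<exists>n\<ge>N. \<forall>i<d. \<forall>j<d. i \<noteq> j \<longrightarrow>
        c / 2 \<le> \<bar>(tent ^^ n) (point F (z i)) - (tent ^^ n) (point F (z j))\<bar>"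
    proof (intro exI conjI allI impI)
      show "N \<le> 2 ^ m" using M[OF m(1)] unfolding N'_def by linarith
      fix i j assume "i < d" "j < d" "i \<noteq> j"
      then show "c / 2 \<le> \<bar>(tent ^^ (2 ^ m)) (point F (z i)) - (tent ^^ (2 ^ m)) (point F (z j))\<bar>"
        using near[of i] near[of j] c(2)[of i j] by linarith
    qed
  qed
  then show ?thesis using c(1) by (intro exI[of _ "c / 2"]) auto
qed

lemma block_map_inj_point:
  assumes "block_map F G" and "inj (\<lambda>n::nat. pt (G (pad (u n))))"
  shows "inj (point F)"
proof (rule injI, rule ccontr)
  fix a b assume eq: "point F a = point F b" and "a \<noteq> b"
  obtain \<delta> where \<delta>: "\<delta> > 0"
    "\<And>z. inj_on z {..<2} \<Longrightarrow> sep_tuple tent \<delta> 2 (\<lambda>i. point F (z i))"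
    using block_map_sep[OF assms, of 2] by blast
  have "sep_tuple tent \<delta> 2 (\<lambda>i. point F ((\<lambda>i. if i = 0 then a else b) i))"
    by (rule \<delta>(2)) (use \<open>a \<noteq> b\<close> in \<open>auto simp: inj_on_def\<close>)
  then have "\<exists>n\<ge>0. \<forall>i<2. \<forall>j<2. i \<noteq> j \<longrightarrow> \<delta> \<le> \<bar>(tent ^^ n) (point F (if i = (0::nat) then a else b))
      - (tent ^^ n) (point F (if j = (0::nat) then a else b))\<bar>"
    unfolding sep_tuple_def by blast
  then obtain n where "\<forall>i<2. \<forall>j<2. i \<noteq> j \<longrightarrow> \<delta> \<le> \<bar>(tent ^^ n) (point F (if i = (0::nat) then a else b))
      - (tent ^^ n) (point F (if j = (0::nat) then a else b))\<bar>" by blast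
  from this[rule_format, of 0 1] show False using eq \<delta>(1) by simp
qed

lemma pad_unit: "pad (replicate n False @ [True]) i \<longleftrightarrow> i = n"
  unfolding pad_def by (auto simp: nth_append less_Suc_eq)

text \<open>The mark sits at an odd position because \<open>pt_spread_inj\<close> asks for sequences
  vanishing at even positions.\<close>

lemma inj_dense_marks: "inj (\<lambda>n. pt (pad (replicate (2 * n + 1) False @ [True])))"
proof (rule injI)
  fix a b :: nat
  let ?s = "\<lambda>a. pad (replicate (2 * a + 1) False @ [True])"
  assume eq: "pt (?s a) = pt (?s b)"
  have ev: "\<not> ?s n i" if "even i" for n i using that unfolding pad_unit by auto
  have "?s a = ?s b"
  proof (rule ccontr)
    assume "?s a \<noteq> ?s b"
    with ev[of _ a] ev[of _ b] have "pt (?s a) \<noteq> pt (?s b)" by (rule pt_spread_inj)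
    then show False using eq by (rule notE)
  qed
  then have "?s a (2 * a + 1) = ?s b (2 * a + 1)" by (rule fun_cong)
  then have "2 * a + 1 = 2 * b + 1" unfolding pad_unit by blast
  then show "a = b" by simp
qed

lemma pt_min_seq_inj: "inj (\<lambda>z. pt (min_seq z))"
proof (rule injI, rule ccontr)
  fix z z' assume "pt (min_seq z) = pt (min_seq z')" "z \<noteq> z'"
  moreover from this have "min_seq z \<noteq> min_seq z'" using min_seq_inj by (simp add: inj_eq)
  then have "pt (min_seq z) \<noteq> pt (min_seq z')" by (intro pt_spread_inj min_seq_even)
  ultimately show False by simp
qed

lemma inj_min_marks: "inj (\<lambda>n. pt (min_seq (pad (replicate n False @ [True]))))"
proof (rule injI)
  fix a b :: nat
  assume "pt (min_seq (pad (replicate a False @ [True]))) = pt (min_seq (pad (replicate b False @ [True])))"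
  then have "pad (replicate a False @ [True]) = pad (replicate b False @ [True])"
    by (rule injD[OF pt_min_seq_inj])
  then show "a = b" unfolding fun_eq_iff pad_unit by blast
qed

lemma dense_orbit:
  assumes "y \<in> {0..1}" "e > 0"
  shows "\<exists>n\<ge>N. \<bar>(tent ^^ n) (point dense_seq z) - y\<bar> < e"
proof -
  obtain s where s: "pt s = y" using pt_surj assms by auto
  obtain k where k: "\<And>s t. (\<And>i. i < k \<Longrightarrow> s i = t i) \<Longrightarrow> \<bar>pt s - pt t\<bar> < e / 2"
    using pt_agree_less[of "e/2"] assms by auto
  define w where "w = map s [0..<k]"
  have 1: "\<bar>pt (pad w) - y\<bar> < e / 2"
    unfolding s[symmetric] by (rule k) (simp add: w_def pad_def)
  obtain M where M: "\<And>m. m \<ge> M \<Longrightarrow> 1 \<le> m \<and> N + length (head_word z) \<le> 2 ^ m \<and>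
      2 * (1/2) ^ (2 ^ m :: nat) < e / 2"
    using large_power[of "e/2" "N + length (head_word z)"] \<open>e > 0\<close> by auto
  obtain m where m: "m \<ge> M" "\<And>z. rl m z = pad w" using rl_const[of M w] by blast
  have "\<bar>(tent ^^ (2 ^ m)) (point dense_seq z) - pt (pad w)\<bar> < e / 2"
    using block_map_point[OF block_map_dense_seq _ _ m(2), of z] M[OF m(1)] by linarith
  then show ?thesis using 1 M[OF m(1)] by (intro exI[of _ "2 ^ m"]) linarith
qed

section \<open>Toeplitz sequences and distal pairs\<close>

function trailing_ones :: "nat \<Rightarrow> nat" where
  "trailing_ones n = (if even n then 0 else Suc (trailing_ones (n div 2)))"
  by pat_completeness auto
termination by (relation "Wellfounded.measure id") (auto elim!: oddE)

declare trailing_ones.simps [simp del]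

text \<open>The numbers \<open>2 ^ (j + 1) * q + 2 ^ j - 1\<close> are those whose binary expansion
  ends in exactly \<open>j\<close> ones. They form an arithmetic progression, hence have bounded
  gaps.\<close>

lemma trailing_ones_eq: "trailing_ones (2 ^ j * (2 * q) + 2 ^ j - 1) = j"
proof (induction j)
  case 0
  show ?case by (simp add: trailing_ones.simps)
next
  case (Suc j)
  have "2 ^ Suc j * (2 * q) + 2 ^ Suc j - 1 = Suc (2 * (2 ^ j * (2 * q) + 2 ^ j - 1))"
    by (cases "(2::nat) ^ j") (simp_all add: algebra_simps)
  then show ?case using Suc by (simp add: trailing_ones.simps[of "Suc _"])
qed

text \<open>Digit \<open>z j\<close> is copied to every position with \<open>j + 1\<close> trailing
  ones. The shift by one keeps the even positions, which have none, equal to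
  \<open>False\<close>.\<close>

definition toeplitz_seq :: "(nat \<Rightarrow> bool) \<Rightarrow> nat \<Rightarrow> bool" where
  "toeplitz_seq z n = (case trailing_ones n of 0 \<Rightarrow> False | Suc j \<Rightarrow> z j)"

lemma finitary_toeplitz_seq: "finitary toeplitz_seq"
  unfolding finitary_def
proof
  fix n
  show "\<exists>k. \<forall>z z'. (\<forall>i<k. z i = z' i) \<longrightarrow> toeplitz_seq z n = toeplitz_seq z' n"
    by (intro exI[of _ "trailing_ones n"]) (auto simp: toeplitz_seq_def split: nat.split)
qed

lemma toeplitz_seq_even: "even n \<Longrightarrow> \<not> toeplitz_seq z n"
  unfolding toeplitz_seq_def by (simp add: trailing_ones.simps)

text \<open>A digit that distinguishes the parameters recurs in both sequences with bounded gaps,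
  and whenever it is read the points are at least 1/4 apart. One step of \<open>tent\<close> at most
  doubles distances, so up to \<open>2 * p\<close> steps earlier they were already
  \<open>\<delta>\<close> apart.\<close>

lemma toeplitz_distal:
  assumes "z \<noteq> z'"
  shows "\<exists>\<delta>>0. \<exists>N. \<forall>n\<ge>N. \<delta> \<le> \<bar>(tent ^^ n) (point toeplitz_seq z) - (tent ^^ n) (point toeplitz_seq z')\<bar>"
proof -
  obtain j where j: "z j \<noteq> z' j" using assms by auto
  define p where "p = (2::nat) ^ (j + 2)"
  define r where "r = (2::nat) ^ (j + 1)"
  have pr: "p = 2 * r" "r \<ge> 2" "even r" unfolding p_def r_def by auto
  define N where "N = length (head_word z) + length (head_word z')"
  define \<delta> where "\<delta> = 1 / (4 * (2::real) ^ (2 * p))"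
  let ?x = "point toeplitz_seq z" and ?y = "point toeplitz_seq z'"
  have "\<delta> \<le> \<bar>(tent ^^ n) ?x - (tent ^^ n) ?y\<bar>" if "n \<ge> N" for n
  proof -
    define q where "q = n div p + 1"
    have n: "n = p * (n div p) + n mod p" "n mod p < p" using pr by auto
    \<comment> \<open>The position \<open>t + 1\<close> has exactly \<open>j + 1\<close> trailing
      ones and is index 1 as seen from the even time \<open>t\<close>; taking \<open>q\<close> one
      larger than \<open>n div p\<close> ensures \<open>t \<ge> n\<close>.\<close>
    define t where "t = p * q + r - 2"
    have "p * q = p * (n div p) + p" unfolding q_def by simp
    then have t: "n \<le> t" "t - n \<le> 2 * p" using n pr(1,2) unfolding t_def by linarith+
    have te: "even t" using pr unfolding t_def by simp
    have "t + 1 = 2 ^ (j + 1) * (2 * q) + 2 ^ (j + 1) - 1"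
      using pr unfolding t_def p_def r_def by (cases "(2::nat) ^ j") auto
    then have tr: "trailing_ones (t + 1) = j + 1" using trailing_ones_eq[of "j + 1" q] by simp
    have "1/4 \<le> \<bar>pt (\<lambda>i. toeplitz_seq z (t + i)) - pt (\<lambda>i. toeplitz_seq z' (t + i))\<bar>"
    proof (rule pt_spread_diff)
      show "toeplitz_seq z (t + 1) \<noteq> toeplitz_seq z' (t + 1)"
        unfolding toeplitz_seq_def tr using j by simp
    qed (simp_all add: toeplitz_seq_even te)
    also have "\<dots> = \<bar>(tent ^^ t) ?x - (tent ^^ t) ?y\<bar>"
      using tent_pow_point[of z t toeplitz_seq] tent_pow_point[of z' t toeplitz_seq] that t
      unfolding N_def by simp
    also have "\<dots> = \<bar>(tent ^^ (t - n)) ((tent ^^ n) ?x) - (tent ^^ (t - n)) ((tent ^^ n) ?y)\<bar>"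
      using funpow_add[of "t - n" n tent] t(1) by simp
    also have "\<dots> \<le> 2 ^ (t - n) * \<bar>(tent ^^ n) ?x - (tent ^^ n) ?y\<bar>" by (rule tent_pow_lipschitz)
    also have "\<dots> \<le> 2 ^ (2 * p) * \<bar>(tent ^^ n) ?x - (tent ^^ n) ?y\<bar>"
      by (intro mult_right_mono power_increasing t) auto
    finally show ?thesis unfolding \<delta>_def by (simp add: field_simps)
  qed
  moreover have "\<delta> > 0" unfolding \<delta>_def by simp
  ultimately show ?thesis by blast
qed

lemma inj_point_toeplitz: "inj (point toeplitz_seq)"
proof (rule injI, rule ccontr)
  fix z z' assume eq: "point toeplitz_seq z = point toeplitz_seq z'" and "z \<noteq> z'"
  then obtain \<delta> N where "\<delta> > 0" "\<forall>n\<ge>N. \<delta> \<le>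
      \<bar>(tent ^^ n) (point toeplitz_seq z) - (tent ^^ n) (point toeplitz_seq z')\<bar>"
    using toeplitz_distal by blast
  then show False using eq by auto
qed

subsection \<open>A minimal Cantor set of the tent map\<close>

definition min_start :: real where
  "min_start = pt (min_seq (pad []))"

definition min_tent :: "real set" where
  "min_tent = closure (range (\<lambda>n. (tent ^^ n) min_start))"

lemma closure_range_iff:
  fixes g :: "'a \<Rightarrow> real"
  shows "a \<in> closure (range g) \<longleftrightarrow> (\<forall>e>0. \<exists>n. \<bar>g n - a\<bar> < e)"
  unfolding closure_approachable dist_real_def by simp

lemma tent_pow_min_start_in: "(tent ^^ n) min_start \<in> min_tent"
  unfolding min_tent_def by (rule subsetD[OF closure_subset]) auto

text \<open>A prefix of \<open>min_seq z\<close> depends on a finite word \<open>w\<close>. A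
  constant rule \<open>m\<close> writes this prefix into block \<open>m\<close> of every
  \<open>min_seq z'\<close>, and every aligned block of length \<open>2 ^ (m + 1)\<close> in any
  \<open>min_seq y\<close> is the beginning of such a sequence. Hence the waiting time is bounded
  independently of \<open>t\<close> and \<open>y\<close>.\<close>

lemma min_seq_uniform_recurrence:
  assumes "e > 0"
  shows "\<exists>N. \<forall>t y. \<exists>n\<le>N. \<bar>(tent ^^ (n + t)) (pt (min_seq y)) - pt (min_seq z)\<bar> < e"
proof -
  obtain k where k: "\<And>s t. (\<And>i. i < k \<Longrightarrow> s i = t i) \<Longrightarrow> \<bar>pt s - pt t\<bar> < e"
    using pt_agree_less[OF assms] by auto
  obtain k' where k': "\<forall>z z'. (\<forall>i<k'. z i = z' i) \<longrightarrow> (\<forall>i<k. min_seq z i = min_seq z' i)"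
    using finitary_prefix[OF finitary_min_seq, of k] by blast
  define w where "w = map z [0..<k']"
  have w: "min_seq (pad w) i = min_seq z i" if "i < k" for i
    by (rule k'[rule_format, OF _ that]) (simp add: w_def pad_def)
  obtain m where m: "m \<ge> Suc k" "\<And>z. rl m z = pad w" using rl_const[of "Suc k" w] by blast
  have km: "k < 2 ^ m" using m(1) less_exp[of m] by linarith
  \<comment> \<open>An aligned block of this length is just long enough to contain positions
    \<open>2 ^ m\<close> to \<open>2 ^ (m + 1) - 1\<close> of its own pattern.\<close>
  define M where "M = (2::nat) ^ Suc m"
  have M: "M = 2 * 2 ^ m" "M > 0" unfolding M_def by auto
  have "\<exists>n\<le>2 * M. \<bar>(tent ^^ (n + t)) (pt (min_seq y)) - pt (min_seq z)\<bar> < e" for t y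
  proof -
    define q where "q = t div M + 1"
    have t: "t = M * (t div M) + t mod M" "t mod M < M" using M by auto
    have q: "q * M = M * (t div M) + M" unfolding q_def by simp
    define n where "n = q * M + 2 ^ m - t"
    have n: "n + t = q * M + 2 ^ m" "n \<le> 2 * M" using q t M(1) unfolding n_def by linarith+
    obtain z' where z': "\<And>i. i < M \<Longrightarrow> min_seq y (q * M + i) = min_seq z' i"
      using min_seq_aligned_block[of "Suc m" y q] unfolding M_def by auto
    have "min_seq y (n + t + i) = min_seq z i" if "i < k" for i
    proof -
      have "min_seq y (n + t + i) = min_seq y (q * M + (2 ^ m + i))" unfolding n(1) by (simp add: add.assoc)
      also have "\<dots> = min_seq z' (2 ^ m + i)" by (rule z') (use that km M in linarith)
      also have "\<dots> = min_seq (pad w) i"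
        using min_seq_block[of m i z'] m km that by simp
      finally show ?thesis using w[OF that] by simp
    qed
    then have "\<bar>pt (\<lambda>i. min_seq y (n + t + i)) - pt (min_seq z)\<bar> < e" by (rule k)
    then show ?thesis unfolding tent_pow_pt using n(2) by (intro exI[of _ n] conjI)
  qed
  then show ?thesis by blast
qed

text \<open>The waiting time bound \<open>N\<close> is fixed before \<open>y\<close> is approximated
  by an orbit point of \<open>min_start\<close>. An approximation within
  \<open>e / 2 / 2 ^ N\<close> therefore survives the at most \<open>N\<close> iterations that
  follow.\<close>

lemma min_tent_approaches:
  assumes "y \<in> min_tent" "e > 0"
  shows "\<exists>n. \<bar>(tent ^^ n) y - pt (min_seq z)\<bar> < e"
proof -
  obtain N where N: "\<And>t y. \<exists>n\<le>N. \<bar>(tent ^^ (n + t)) (pt (min_seq y)) - pt (min_seq z)\<bar> < e / 2"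
    using min_seq_uniform_recurrence[of "e/2" z] assms(2) by auto
  have "e / 2 / 2 ^ N > 0" using assms(2) by simp
  then obtain t where t: "\<bar>(tent ^^ t) min_start - y\<bar> < e / 2 / 2 ^ N"
    using assms(1) unfolding min_tent_def closure_range_iff by metis
  obtain n where n: "n \<le> N" "\<bar>(tent ^^ (n + t)) min_start - pt (min_seq z)\<bar> < e / 2"
    using N[of t "pad []"] unfolding min_start_def by blast
  have "\<bar>(tent ^^ n) ((tent ^^ t) min_start) - (tent ^^ n) y\<bar> \<le> 2 ^ n * \<bar>(tent ^^ t) min_start - y\<bar>"
    by (rule tent_pow_lipschitz)
  also have "\<dots> \<le> 2 ^ N * \<bar>(tent ^^ t) min_start - y\<bar>"
    using n(1) by (intro mult_right_mono power_increasing) auto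
  also have "\<dots> < e / 2" using t by (simp add: field_simps)
  finally have "\<bar>(tent ^^ n) y - pt (min_seq z)\<bar> < e"
    using n(2) unfolding funpow_add comp_apply by linarith
  then show ?thesis by blast
qed

lemma closed_min_tent: "closed min_tent"
  unfolding min_tent_def by simp

lemma min_start_in: "min_start \<in> min_tent"
  using tent_pow_min_start_in[of 0] by simp

lemma min_tent_subset: "min_tent \<subseteq> {0..1}"
  unfolding min_tent_def
  by (rule closure_minimal) (use pt_in tent_pow_in in \<open>auto simp: min_start_def simp del: atLeastAtMost_iff\<close>)

lemma tent_min_tent: "tent ` min_tent \<subseteq> min_tent"
  unfolding min_tent_def
proof (rule image_closure_subset[OF continuous_on_tent closed_closure])
  show "tent ` range (\<lambda>n. (tent ^^ n) min_start) \<subseteq> closure (range (\<lambda>n. (tent ^^ n) min_start))"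
    using tent_pow_min_start_in[of "Suc _"] unfolding min_tent_def by auto
qed

lemma pt_min_seq_in: "pt (min_seq z) \<in> min_tent"
proof -
  have "\<exists>n. \<bar>(tent ^^ n) min_start - pt (min_seq z)\<bar> < e" if "e > 0" for e
    using min_tent_approaches[OF min_start_in that] .
  then show ?thesis unfolding min_tent_def closure_range_iff by simp
qed

text \<open>The orbit of \<open>y\<close> comes so close to \<open>min_start\<close> that it shadows
  the next \<open>j\<close> iterates of \<open>min_start\<close>, and these end near
  \<open>a\<close>.\<close>

lemma min_tent_dense_orbit:
  assumes "y \<in> min_tent" "a \<in> min_tent" "e > 0"
  shows "\<exists>n. \<bar>(tent ^^ n) y - a\<bar> < e"
proof -
  obtain j where j: "\<bar>(tent ^^ j) min_start - a\<bar> < e / 2"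
    using assms(2,3) unfolding min_tent_def closure_range_iff by (metis half_gt_zero)
  obtain n where n: "\<bar>(tent ^^ n) y - min_start\<bar> < e / 2 / 2 ^ j"
    using min_tent_approaches[OF assms(1), of "e / 2 / 2 ^ j"] assms(3) unfolding min_start_def by auto
  have "\<bar>(tent ^^ j) ((tent ^^ n) y) - (tent ^^ j) min_start\<bar> \<le> 2 ^ j * \<bar>(tent ^^ n) y - min_start\<bar>"
    by (rule tent_pow_lipschitz)
  also have "\<dots> < e / 2" using n by (simp add: field_simps)
  finally have "\<bar>(tent ^^ (j + n)) y - a\<bar> < e"
    using j unfolding funpow_add comp_apply by linarith
  then show ?thesis by blast
qed

lemma minimal_set_min_tent: "minimal_set tent min_tent"
  unfolding minimal_set_def
proof (intro conjI allI impI closed_min_tent min_tent_subset tent_min_tent)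
  show "min_tent \<noteq> {}" using min_start_in by blast
  fix B assume B: "B \<noteq> {} \<and> closed B \<and> B \<subseteq> min_tent \<and> tent ` B \<subseteq> B"
  then obtain y where y: "y \<in> B" by blast
  have orb: "(tent ^^ n) y \<in> B" for n by (induction n) (use y B in auto)
  have "a \<in> closure B" if "a \<in> min_tent" for a
  proof -
    have "a \<in> closure (range (\<lambda>n. (tent ^^ n) y))"
      unfolding closure_range_iff using min_tent_dense_orbit[of y a] y B that by auto
    moreover have "range (\<lambda>n. (tent ^^ n) y) \<subseteq> B" using orb by auto
    ultimately show ?thesis using closure_mono by blast
  qed
  then show "B = min_tent" using B by auto
qed

lemma infinite_min_tent: "infinite min_tent"
proof
  assume "finite min_tent"
  then have "finite (range (\<lambda>n. pt (min_seq (pad (replicate n False @ [True])))))"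
    by (rule rev_finite_subset) (use pt_min_seq_in in auto)
  then show False using inj_min_marks finite_imageD infinite_UNIV_nat by blast
qed

lemma min_tent_pow_in: "y \<in> min_tent \<Longrightarrow> (tent ^^ n) y \<in> min_tent"
  by (induction n) (use tent_min_tent in auto)

lemma min_tent_sub_eq:
  assumes "B \<noteq> {}" "closed B" "B \<subseteq> min_tent" "tent ` B \<subseteq> B"
  shows "B = min_tent"
  using minimal_set_min_tent assms unfolding minimal_set_def by blast

text \<open>A point that is isolated in \<open>min_tent\<close> would be hit again by its own dense
  orbit, hence be periodic. Its finite cycle would be closed and invariant, thus equal to the
  infinite set \<open>min_tent\<close>.\<close>

lemma min_tent_islimpt:
  assumes "a \<in> min_tent"
  shows "a islimpt min_tent"
proof (rule ccontr)
  assume "\<not> a islimpt min_tent"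
  then obtain e where e: "e > 0" "\<And>x. x \<in> min_tent \<Longrightarrow> dist x a < e \<Longrightarrow> x = a"
    unfolding islimpt_approachable by blast
  \<comment> \<open>Starting from \<open>tent a\<close> rather than \<open>a\<close> makes the
    return time positive.\<close>
  have ta: "tent a \<in> min_tent" using tent_min_tent assms by auto
  obtain n where "\<bar>(tent ^^ n) (tent a) - a\<bar> < e" using min_tent_dense_orbit[OF ta assms e(1)] by blast
  then have per: "(tent ^^ Suc n) a = a"
    using e(2)[OF min_tent_pow_in[OF ta, of n]] unfolding dist_real_def by (simp add: funpow_swap1)
  define B where "B = (\<lambda>k. (tent ^^ k) a) ` {..n}"
  have "tent x \<in> B" if "x \<in> B" for x
  proof -
    obtain k where k: "k \<le> n" "x = (tent ^^ k) a" using \<open>x \<in> B\<close> unfolding B_def by auto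
    show ?thesis
    proof (cases "k = n")
      case True
      then have "tent x = (tent ^^ 0) a" using k per by simp
      then show ?thesis unfolding B_def by blast
    next
      case False
      then have "tent x = (tent ^^ Suc k) a" "Suc k \<le> n" using k by auto
      then show ?thesis unfolding B_def by blast
    qed
  qed
  moreover have "finite B" "B \<noteq> {}" unfolding B_def by auto
  moreover have "B \<subseteq> min_tent" unfolding B_def using min_tent_pow_in[OF assms] by auto
  ultimately have "B = min_tent" by (intro min_tent_sub_eq finite_imp_closed) auto
  then show False using infinite_min_tent \<open>finite B\<close> by simp
qed

text \<open>Every interval contains a dyadic rational, which the tent map eventually sends to the
  fixed point \<open>0\<close>.\<close>

lemma min_tent_no_interval:
  assumes "c < d" "{c..d} \<subseteq> min_tent"
  shows False
proof -
  define x where "x = (c + d) / 2"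
  have "c \<in> min_tent" "d \<in> min_tent" using assms by auto
  then have "c \<in> {0..1}" "d \<in> {0..1}" using min_tent_subset by blast+
  then obtain s where s: "pt s = x" using pt_surj[of x] unfolding x_def by auto
  obtain k where k: "\<And>s t. (\<And>i. i < k \<Longrightarrow> s i = t i) \<Longrightarrow> \<bar>pt s - pt t\<bar> < (d - c) / 2"
    using pt_agree_less[of "(d - c) / 2"] assms(1) by auto
  define w where "w = map s [0..<k]"
  have "\<bar>pt s - pt (pad w)\<bar> < (d - c) / 2" by (rule k) (simp add: w_def pad_def)
  then have "c \<le> pt (pad w)" "pt (pad w) \<le> d" unfolding s x_def abs_less_iff by argo+
  then have "pt (pad w) \<in> min_tent" using assms(2) by auto
  then have "(tent ^^ k) (pt (pad w)) \<in> min_tent" by (rule min_tent_pow_in)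
  moreover have "(tent ^^ k) (pt (pad w)) = pt (\<lambda>_. False)"
    unfolding tent_pow_pt by (simp add: pad_def w_def)
  moreover have "pt (\<lambda>_. False) = 0" by (simp add: pt_def bin_def tent_def)
  ultimately have "0 \<in> min_tent" by simp
  then have "{0} = min_tent" by (intro min_tent_sub_eq) (auto simp: tent_def)
  then show False using infinite_min_tent by (metis finite.emptyI finite_insert)
qed

text \<open>The head word may put the point itself outside \<open>min_tent\<close>; once it has been
  read, the orbit coincides with that of \<open>pt (min_seq z)\<close>.\<close>

lemma point_min_seq_eventually:
  "n \<ge> length (head_word z) \<Longrightarrow> (tent ^^ n) (point min_seq z) \<in> min_tent"
  using tent_pow_point[of z n min_seq] min_tent_pow_in[OF pt_min_seq_in, of n z]
  by (simp add: tent_pow_pt)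

lemma point_min_seq_dense:
  assumes "a \<in> min_tent" "e > 0"
  shows "\<exists>n\<ge>N. \<bar>(tent ^^ n) (point min_seq z) - a\<bar> < e"
proof -
  define k where "k = N + length (head_word z)"
  have "(tent ^^ k) (point min_seq z) \<in> min_tent" unfolding k_def by (rule point_min_seq_eventually) simp
  then obtain n where "\<bar>(tent ^^ n) ((tent ^^ k) (point min_seq z)) - a\<bar> < e"
    using min_tent_dense_orbit assms by blast
  then show ?thesis unfolding k_def by (intro exI[of _ "n + (N + length (head_word z))"]) (simp add: funpow_add)
qed

subsection \<open>Coin tossing\<close>

text \<open>Second countability of the factors makes the product sigma-algebra of the coin space its
  Borel sigma-algebra.\<close>

instance bool :: second_countable_topology
proof
  show "\<exists>B::bool set set. countable B \<and> open = generate_topology B"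
    by (intro exI[of _ "range lessThan \<union> range greaterThan"]) (auto simp: open_bool_def)
qed

definition coin :: "(nat \<Rightarrow> bool) measure" where
  "coin = Pi\<^sub>M UNIV (\<lambda>_. uniform_count_measure UNIV)"

lemma sets_coin [measurable_cong]: "sets coin = sets borel"
proof -
  have "sets (uniform_count_measure (UNIV :: bool set)) = sets borel"
    by (simp add: sets_uniform_count_measure sets_borel_eq_count_space)
  then have "sets coin = sets (Pi\<^sub>M UNIV (\<lambda>_::nat. borel :: bool measure))"
    unfolding coin_def by (intro sets_PiM_cong) auto
  then show ?thesis by (simp only: sets_PiM_equal_borel)
qed

lemma space_coin [simp]: "space coin = UNIV"
  using sets_eq_imp_space_eq[OF sets_coin] by simp

lemma prob_space_coin: "prob_space coin"
  unfolding coin_def by (intro prob_space_PiM prob_space_uniform_count_measure) auto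

definition cylinder :: "(nat \<Rightarrow> bool) \<Rightarrow> nat \<Rightarrow> (nat \<Rightarrow> bool) set" where
  "cylinder s n = {z. \<forall>i<n. z i = s i}"

lemma emeasure_coin_cylinder: "emeasure coin (cylinder s n) = ennreal ((1/2) ^ n)"
proof -
  let ?M = "\<lambda>_::nat. uniform_count_measure (UNIV :: bool set)"
  have "cylinder s n = prod_emb UNIV ?M {..<n} (Pi\<^sub>E {..<n} (\<lambda>i. {s i}))"
    by (auto simp: cylinder_def prod_emb_def space_uniform_count_measure restrict_def PiE_iff extensional_def)
  then have "emeasure coin (cylinder s n) = (\<Prod>i<n. emeasure (uniform_count_measure UNIV) {s i})"
    unfolding coin_def
    by (simp only:) (intro emeasure_PiM_emb prob_space_uniform_count_measure; simp add: sets_uniform_count_measure)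
  also have "\<dots> = (\<Prod>i<n. ennreal (1/2))"
    by (intro prod.cong refl) (simp add: emeasure_uniform_count_measure)
  also have "\<dots> = ennreal (1/2) ^ n" by simp
  finally show ?thesis by (simp only: ennreal_power)
qed

lemma open_closed_digit: "open {z :: nat \<Rightarrow> bool. z i = b}" "closed {z :: nat \<Rightarrow> bool. z i = b}"
proof -
  have o: "open {b}" for b :: bool
  proof (cases b)
    case True
    then have "{b} = {False<..}" by auto
    then show ?thesis by simp
  next
    case False
    then have "{b} = {..<True}" by auto
    then show ?thesis by simp
  qed
  have "open ((\<lambda>z :: nat \<Rightarrow> bool. z i) -` {b})" for b
    by (rule open_vimage[OF o]) simp
  then have *: "open {z :: nat \<Rightarrow> bool. z i = b}" for b by (simp add: vimage_def)
  show "open {z :: nat \<Rightarrow> bool. z i = b}" by (rule *)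
  have "- {z :: nat \<Rightarrow> bool. z i = b} = {z. z i = (\<not> b)}" by auto
  then show "closed {z :: nat \<Rightarrow> bool. z i = b}" unfolding closed_def using * by simp
qed

lemma open_cylinder: "open (cylinder s n)" and closed_cylinder: "closed (cylinder s n)"
proof -
  have *: "cylinder s n = (\<Inter>i\<in>{..<n}. {z. z i = s i})" unfolding cylinder_def by auto
  show "open (cylinder s n)" unfolding * by (intro open_INT ballI open_closed_digit finite_lessThan)
  show "closed (cylinder s n)" unfolding * by (intro closed_INT ballI open_closed_digit)
qed

lemma closed_bits_singleton: "closed {z :: nat \<Rightarrow> bool}"
proof -
  have "{z} = (\<Inter>i. {y. y i = z i})" by auto
  moreover have "closed (\<Inter>i. {y. y i = z i})" by (intro closed_INT ballI open_closed_digit)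
  ultimately show ?thesis by (simp only:)
qed

lemma compact_bits: "compact (UNIV :: (nat \<Rightarrow> bool) set)"
proof -
  have "compact_space (euclidean :: bool topology)"
    by (simp add: compact_space_def compactin_euclidean_iff finite_imp_compact)
  then have "compact_space (product_topology (\<lambda>_::nat. euclidean :: bool topology) UNIV)"
    by (simp add: compact_space_product_topology)
  then show ?thesis
    by (simp add: euclidean_product_topology compact_space_def compactin_euclidean_iff)
qed

lemma coin_singleton: "measure coin {z} = 0"
proof -
  interpret prob_space coin by (rule prob_space_coin)
  have "measure coin {z} \<le> (1/2) ^ n" for n
  proof -
    have "measure coin {z} \<le> measure coin (cylinder z n)"
      using closed_cylinder[of z n] by (intro finite_measure_mono) (auto simp: cylinder_def sets_coin)
    also have "\<dots> = (1/2) ^ n"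
      using emeasure_coin_cylinder[of z n] by (simp add: emeasure_eq_measure)
    finally show ?thesis .
  qed
  then have "\<not> 0 < measure coin {z}"
    using real_arch_pow_inv[of "measure coin {z}" "1/2"] by (force simp: not_less[symmetric])
  then show ?thesis using measure_nonneg[of coin "{z}"] by linarith
qed

lemma continuous_on_bits:
  fixes g :: "(nat \<Rightarrow> bool) \<Rightarrow> real"
  assumes "\<And>e. e > 0 \<Longrightarrow> \<exists>k. \<forall>z z'. (\<forall>i<k. z i = z' i) \<longrightarrow> \<bar>g z - g z'\<bar> < e"
  shows "continuous_on UNIV g"
  unfolding continuous_on_topological
proof (intro ballI allI impI)
  fix z B assume B: "open B" "g z \<in> B"
  then obtain e where e: "e > 0" "\<And>x. dist x (g z) < e \<Longrightarrow> x \<in> B" unfolding open_dist by blast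
  obtain k where k: "\<forall>z z'. (\<forall>i<k. z i = z' i) \<longrightarrow> \<bar>g z - g z'\<bar> < e" using assms[OF e(1)] by blast
  have "g y \<in> B" if "y \<in> cylinder z k" for y
    using that k e(2) unfolding cylinder_def dist_real_def by blast
  then show "\<exists>A. open A \<and> z \<in> A \<and> (\<forall>y\<in>UNIV. y \<in> A \<longrightarrow> g y \<in> B)"
    using open_cylinder[of z k] by (intro exI[of _ "cylinder z k"]) (auto simp: cylinder_def)
qed

lemma continuous_on_pt_override:
  assumes "finitary F"
  shows "continuous_on UNIV (\<lambda>z. pt (override w (F z)))"
proof (rule continuous_on_bits)
  fix e :: real assume "e > 0"
  obtain k where k: "\<And>s t. (\<And>i. i < k \<Longrightarrow> s i = t i) \<Longrightarrow> \<bar>pt s - pt t\<bar> < e"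
    using pt_agree_less[OF \<open>e > 0\<close>] by auto
  obtain k' where k': "\<forall>z z'. (\<forall>i<k'. z i = z' i) \<longrightarrow> (\<forall>i<k. F z i = F z' i)"
    using finitary_prefix[OF assms, of k] by blast
  have "\<bar>pt (override w (F z)) - pt (override w (F z'))\<bar> < e" if "\<forall>i<k'. z i = z' i" for z z'
    by (rule k) (use k' that in \<open>simp add: override_def\<close>)
  then show "\<exists>k'. \<forall>z z'. (\<forall>i<k'. z i = z' i) \<longrightarrow>
      \<bar>pt (override w (F z)) - pt (override w (F z'))\<bar> < e" by blast
qed

text \<open>Index \<open>n\<close> carries the digit \<open>False\<close>, so there are exactly
  \<open>n\<close> leading \<open>True\<close> digits. These clopen pieces fill Cantor space up to
  one point, and \<open>head_word\<close> is constant on each, which makes \<open>point F\<close>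
  continuous there.\<close>

definition ones_block :: "nat \<Rightarrow> (nat \<Rightarrow> bool) set" where
  "ones_block n = cylinder (\<lambda>i. i < n) (Suc n)"

lemma head_word_ones_block:
  assumes "z \<in> ones_block n"
  shows "head_word z = from_nat n"
proof -
  have z: "z i \<longleftrightarrow> i < n" if "i \<le> n" for i
    using assms that unfolding ones_block_def cylinder_def by auto
  have "(LEAST i. \<not> z i) = n"
  proof (rule Least_equality)
    show "\<not> z n" using z[of n] by simp
    show "n \<le> i" if "\<not> z i" for i using z[of i] that by (cases "i \<le> n") auto
  qed
  then show ?thesis unfolding head_word_def by simp
qed

lemma point_ones_block: "z \<in> ones_block n \<Longrightarrow> point F z = pt (override (from_nat n) (F z))"
  unfolding point_def by (simp add: head_word_ones_block)

lemma ones_cover: "insert (\<lambda>_. True) (\<Union>n. ones_block n) = UNIV"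
proof (intro equalityI subset_UNIV subsetI)
  fix z :: "nat \<Rightarrow> bool"
  show "z \<in> insert (\<lambda>_. True) (\<Union>n. ones_block n)"
  proof (cases "\<exists>n. \<not> z n")
    case True
    then have "\<not> z (LEAST i. \<not> z i)" by (rule LeastI_ex)
    then have "z \<in> ones_block (LEAST i. \<not> z i)"
      unfolding ones_block_def cylinder_def using not_less_Least by (auto simp: less_Suc_eq)
    then show ?thesis by blast
  next
    case False
    then have "z = (\<lambda>_. True)" by auto
    then show ?thesis by simp
  qed
qed

lemma point_measurable:
  assumes "finitary F"
  shows "point F \<in> borel_measurable coin"
\<comment> \<open>Index 0 of the cover is reserved for the constant sequence \<open>True\<close>;
  the pieces \<open>ones_block n\<close> are shifted by one.\<close>
proof (rule measurable_piecewise_restrict2[where A = "\<lambda>n. case n of 0 \<Rightarrow> {\<lambda>_. True} | Suc n \<Rightarrow> ones_block n"])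
  show "(case n of 0 \<Rightarrow> {\<lambda>_. True} | Suc n \<Rightarrow> ones_block n) \<in> sets coin" for n
    unfolding sets_coin ones_block_def
    by (cases n) (auto intro!: borel_closed closed_bits_singleton closed_cylinder)
  have "(\<Union>n. case n of 0 \<Rightarrow> {\<lambda>_. True} | Suc n \<Rightarrow> ones_block n) = insert (\<lambda>_. True) (\<Union>n. ones_block n)"
    (is "(\<Union>n. ?A n) = _")
  proof -
    have "(\<Union>n. ?A n) = ?A 0 \<union> (\<Union>n. ?A (Suc n))"
    proof (intro equalityI subsetI)
      fix x assume "x \<in> (\<Union>n. ?A n)"
      then obtain n where "x \<in> ?A n" by blast
      then show "x \<in> ?A 0 \<union> (\<Union>n. ?A (Suc n))" by (cases n) auto
    qed blast
    then show ?thesis by simp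
  qed
  then show "space coin = (\<Union>n. case n of 0 \<Rightarrow> {\<lambda>_. True} | Suc n \<Rightarrow> ones_block n)"
    using ones_cover by simp
  fix n
  have m: "(\<lambda>z. pt (override w (F z))) \<in> borel_measurable coin" for w
    unfolding measurable_cong_sets[OF sets_coin refl]
    by (intro borel_measurable_continuous_onI continuous_on_pt_override assms)
  have *: "\<exists>h\<in>borel_measurable coin. \<forall>x\<in>A. point F x = h x"
    if "\<forall>x\<in>A. point F x = pt (override w (F x))" for A w
    using that m[of w] by (rule bexI)
  show "\<exists>h\<in>borel_measurable coin.
      \<forall>x\<in>(case n of 0 \<Rightarrow> {\<lambda>_. True} | Suc n \<Rightarrow> ones_block n). point F x = h x"
  proof (cases n)
    case 0
    then show ?thesis
      by (intro *[where w = "head_word (\<lambda>_. True)"]) (simp add: point_def)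
  next
    case (Suc m)
    then show ?thesis
      by (intro *[where w = "from_nat m"]) (simp add: point_ones_block)
  qed
qed

text \<open>The range is a countable union of compact sets: the continuous images of the compact
  pieces \<open>ones_block n\<close>, and one further point.\<close>

lemma range_point_borel:
  assumes "finitary F"
  shows "range (point F) \<in> sets borel"
proof -
  have "compact (point F ` ones_block n)" for n
  proof -
    have "compact (ones_block n)"
      using compact_Int_closed[OF compact_bits closed_cylinder] unfolding ones_block_def by simp
    then have "compact ((\<lambda>z. pt (override (from_nat n) (F z))) ` ones_block n)"
      by (intro compact_continuous_image)
         (rule continuous_on_subset[OF continuous_on_pt_override[OF assms] subset_UNIV])
    then show ?thesis using point_ones_block by (simp cong: image_cong)
  qed
  then have "point F ` ones_block n \<in> sets borel" for n by (intro borel_closed compact_imp_closed)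
  then have "insert (point F (\<lambda>_. True)) (\<Union>n. point F ` ones_block n) \<in> sets borel" by auto
  moreover have "range (point F) = insert (point F (\<lambda>_. True)) (\<Union>n. point F ` ones_block n)"
    unfolding ones_cover[symmetric] by auto
  ultimately show ?thesis by simp
qed

text \<open>Taking a long prefix of a code of the midpoint as head word forces the point into the
  interval, whatever \<open>F\<close> contributes afterwards. This is what makes the distribution
  function strictly increasing.\<close>

lemma ones_block_in_interval:
  assumes "0 \<le> x" "x < y" "y \<le> 1"
  obtains n where "\<And>z. z \<in> ones_block n \<Longrightarrow> point F z \<in> {x<..<y}"
proof -
  obtain s where s: "pt s = (x + y) / 2" using pt_surj[of "(x + y) / 2"] assms by auto
  obtain k where k: "\<And>s t. (\<And>i. i < k \<Longrightarrow> s i = t i) \<Longrightarrow> \<bar>pt s - pt t\<bar> < (y - x) / 2"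
    using pt_agree_less[of "(y - x) / 2"] assms by auto
  define w where "w = map s [0..<k]"
  have "point F z \<in> {x<..<y}" if "z \<in> ones_block (to_nat w)" for z
  proof -
    have "point F z = pt (override w (F z))" using point_ones_block[OF that, of F] by simp
    moreover have "\<bar>pt s - pt (override w (F z))\<bar> < (y - x) / 2"
      by (rule k) (simp add: w_def override_def)
    ultimately have "\<bar>(x + y) / 2 - point F z\<bar> < (y - x) / 2" unfolding s by simp
    then show ?thesis unfolding abs_less_iff by (simp add: field_simps)
  qed
  then show ?thesis by (rule that)
qed

lemma coin_ones_block: "measure coin (ones_block n) > 0"
  using emeasure_coin_cylinder[of "\<lambda>i. i < n" "Suc n"] unfolding ones_block_def
  by (simp add: measure_def del: power_Suc)

subsection \<open>Homeomorphisms from distribution functions\<close>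

text \<open>The law \<open>\<mu>\<close> of \<open>point F\<close> has no atoms and charges every
  subinterval, so its distribution function \<open>h\<close> is a homeomorphism of the unit
  interval, and it carries \<open>\<mu>\<close> to Lebesgue measure. The last conclusion later shows
  that the image of the minimal set has positive measure.\<close>

lemma full_measure_homeomorphism:
  assumes fin: "finitary F" and inj: "inj (point F)"
  obtains h h' where "homeomorphism {0..1} {0..1} h h'"
    "full_measure (h ` range (point F))"
    "\<And>n B. compact B \<Longrightarrow> B \<subseteq> {0..1} \<Longrightarrow> point F ` ones_block n \<subseteq> B \<Longrightarrow> emeasure lebesgue (h ` B) > 0"
proof -
  define \<mu> where "\<mu> = distr coin borel (point F)"
  interpret C: prob_space coin by (rule prob_space_coin)
  have pm [measurable]: "point F \<in> borel_measurable coin" using point_measurable[OF fin] .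
  interpret R: real_distribution \<mu> unfolding \<mu>_def by (rule C.real_distribution_distr[OF pm])
  have \<mu>: "measure \<mu> B = measure coin {z. point F z \<in> B}" if "B \<in> sets borel" for B
    unfolding \<mu>_def using measure_distr[OF pm that] by (simp add: vimage_def)
  have mono: "measure \<mu> B \<ge> measure coin (ones_block n)"
    if "B \<in> sets borel" "\<And>z. z \<in> ones_block n \<Longrightarrow> point F z \<in> B" for B n
    unfolding \<mu>[OF that(1)] by (rule C.finite_measure_mono) (use that pm in auto)
  \<comment> \<open>Injectivity leaves at most one parameter over \<open>x\<close>, and single
    parameters have probability zero; so \<open>h\<close> has no jumps.\<close>
  have null: "measure \<mu> {x} = 0" for x
  proof -
    have "\<exists>z. {z. point F z \<in> {x}} \<subseteq> {z}" using inj unfolding inj_def by blast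
    then obtain z where "{z. point F z \<in> {x}} \<subseteq> {z}" by blast
    then have "measure coin {z. point F z \<in> {x}} \<le> measure coin {z}"
      by (intro C.finite_measure_mono) (auto simp: sets_coin closed_bits_singleton)
    then show ?thesis using \<mu>[of "{x}"] coin_singleton[of z] by (simp add: measure_le_0_iff)
  qed
  define h where "h = cdf \<mu>"
  have cont: "isCont h x" for x unfolding h_def using R.isCont_cdf null by blast
  have h_mono: "x \<le> y \<Longrightarrow> h x \<le> h y" for x y unfolding h_def by (rule R.cdf_nondecreasing)
  have h_low: "h x = 0" if "x < 0" for x
  proof -
    have "point F z \<notin> {..x}" for z using point_in[of F z] that by auto
    then have "{z. point F z \<in> {..x}} = {}" by blast
    then show ?thesis using \<mu>[of "{..x}"] unfolding h_def cdf_def by simp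
  qed
  have h0: "h 0 = 0"
  proof -
    have "point F z \<in> {..0} \<longleftrightarrow> point F z \<in> {0}" for z using point_in[of F z] by auto
    then have "{z. point F z \<in> {..0}} = {z. point F z \<in> {0}}" by blast
    then show ?thesis using \<mu>[of "{..0}"] \<mu>[of "{0}"] null[of 0] unfolding h_def cdf_def by simp
  qed
  have h_high: "h x = 1" if "x \<ge> 1" for x
  proof -
    have "point F z \<in> {..x}" for z using point_in[of F z] that by auto
    then have "{z. point F z \<in> {..x}} = space coin" by simp
    then show ?thesis using \<mu>[of "{..x}"] C.prob_space unfolding h_def cdf_def by simp
  qed
  have h_strict: "h x < h y" if xy: "0 \<le> x" "x < y" "y \<le> 1" for x y
  proof -
    obtain n where n: "\<And>z. z \<in> ones_block n \<Longrightarrow> point F z \<in> {x<..<y}"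
      using ones_block_in_interval[OF xy, of F] by metis
    have "measure \<mu> {x<..y} \<ge> measure coin (ones_block n)" by (rule mono) (use n in force)+
    then show ?thesis using R.cdf_diff_eq[OF xy(2)] coin_ones_block[of n] unfolding h_def by linarith
  qed
  have h_le_iff: "h x \<le> h y \<longleftrightarrow> x \<le> y" if "x \<in> {0..1}" "y \<in> {0..1}" for x y
    using h_strict[of y x] h_mono[of x y] that by (auto simp: not_le[symmetric])
  have h_cont: "continuous_on {0..1} h" by (intro continuous_at_imp_continuous_on ballI cont)
  have h_img: "h ` {0..1} = {0..1}"
  proof
    show "h ` {0..1} \<subseteq> {0..1}" using h_mono[of 0] h_mono[of _ 1] h0 h_high[of 1] by auto
    show "{0..1} \<subseteq> h ` {0..1}"
    proof
      fix c :: real assume "c \<in> {0..1}"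
      then have "\<exists>x\<ge>0. x \<le> 1 \<and> h x = c" using IVT'[of h 0 c 1] h0 h_high[of 1] h_cont by auto
      then show "c \<in> h ` {0..1}" by auto
    qed
  qed
  have h_inj: "inj_on h {0..1}"
  proof (rule inj_onI)
    fix x y assume "x \<in> {0..1}" "y \<in> {0..1}" "h x = h y"
    then show "x = y" using h_le_iff[of x y] h_le_iff[of y x] by simp
  qed
  obtain g where g: "homeomorphism {0..1} {0..1} h g"
    using homeomorphism_compact[OF compact_Icc h_cont h_img h_inj] by blast
  have gh: "g (h x) = x" if "x \<in> {0..1}" for x using homeomorphism_apply1[OF g that] .
  have hg: "h (g c) = c" if "c \<in> {0..1}" for c using homeomorphism_apply2[OF g that] .
  have g_in: "g c \<in> {0..1}" if "c \<in> {0..1}" for c using g that unfolding homeomorphism_def by auto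
  have h_in: "h x \<in> {0..1}" if "x \<in> {0..1}" for x using h_img that by auto
  define g' where "g' c = (if c \<in> {0..1} then g c else 0)" for c
  have g'[measurable]: "g' \<in> borel_measurable borel"
    unfolding g'_def using g
    by (intro borel_measurable_continuous_on_if) (auto simp: homeomorphism_def)
  define U where "U = uniform_measure lborel {0..1::real}"
  have U1: "prob_space U" unfolding U_def by (intro prob_space_uniform_measure) auto
  have setsU [measurable_cong]: "sets U = sets borel" unfolding U_def by simp
  interpret U: prob_space U by (rule U1)
  have eU: "emeasure U B = emeasure lborel ({0..1} \<inter> B)" if "B \<in> sets borel" for B
    unfolding U_def using that by (subst emeasure_uniform_measure) (auto simp: divide_ennreal_def)
  \<comment> \<open>Quantile transform: the inverse of \<open>h\<close> applied to a uniform
    variable has distribution function \<open>h\<close>, so its law \<open>\<nu>\<close> is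
    \<open>\<mu>\<close> by uniqueness of distribution functions.\<close>
  define \<nu> where "\<nu> = distr U borel g'"
  have g'U: "g' \<in> borel_measurable U" using g' by (simp add: measurable_cong_sets[OF setsU refl])
  interpret N: real_distribution \<nu> unfolding \<nu>_def by (rule U.real_distribution_distr[OF g'U])
  have spU: "space U = UNIV" unfolding U_def by simp
  have \<nu>: "emeasure \<nu> B = emeasure lborel ({0..1} \<inter> g' -` B)" if "B \<in> sets borel" for B
    unfolding \<nu>_def using emeasure_distr[OF g'U that] eU[of "g' -` B"] measurable_sets_borel[OF g' that]
    by (simp add: spU)
  have "cdf \<nu> x = cdf \<mu> x" for x
  proof -
    have *: "emeasure \<nu> {..x} = ennreal (h x)"
    proof (cases "x \<in> {0..1}")
      case True
      have "{0..1} \<inter> g' -` {..x} = {0..h x}"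
      proof (intro equalityI subsetI)
        fix c assume "c \<in> {0..1} \<inter> g' -` {..x}"
        then have c: "c \<in> {0..1}" "g c \<le> x" unfolding g'_def by auto
        then have "h (g c) \<le> h x" using h_mono by blast
        then show "c \<in> {0..h x}" using c hg[OF c(1)] by simp
      next
        fix c assume "c \<in> {0..h x}"
        then have c: "c \<in> {0..1}" "h (g c) \<le> h x" using h_in[OF True] hg[of c] by auto
        then have "g c \<le> x" using h_le_iff[OF g_in[OF c(1)] True] by simp
        then show "c \<in> {0..1} \<inter> g' -` {..x}" using c unfolding g'_def by auto
      qed
      then show ?thesis using \<nu>[of "{..x}"] h_in[OF True] by simp
    next
      case False
      show ?thesis
      proof (cases "x < 0")
        case True
        then have "{0..1} \<inter> g' -` {..x} = {}" using g_in unfolding g'_def by fastforce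
        then show ?thesis using \<nu>[of "{..x}"] h_low[OF True] by simp
      next
        case f: False
        then have "x \<ge> 1" using False by auto
        then have "{0..1} \<inter> g' -` {..x} = {0..1}" using g_in unfolding g'_def by fastforce
        then show ?thesis using \<nu>[of "{..x}"] h_high[OF \<open>x \<ge> 1\<close>] by simp
      qed
    qed
    show ?thesis using * R.cdf_nonneg[of x] unfolding h_def cdf_def[of \<nu>] by (simp add: measure_def)
  qed
  then have "\<nu> = \<mu>"
    by (intro cdf_unique) (auto intro: N.real_distribution_axioms R.real_distribution_axioms)
  \<comment> \<open>Writing an image under \<open>h\<close> as a preimage under \<open>g'\<close>
    yields its measurability and its Lebesgue measure at once.\<close>
  have img: "{0..1} \<inter> g' -` B = h ` B" if "B \<subseteq> {0..1}" for B
  proof (intro equalityI subsetI)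
    fix c assume "c \<in> {0..1} \<inter> g' -` B"
    then have "c \<in> {0..1}" "g c \<in> B" unfolding g'_def by auto
    then show "c \<in> h ` B" using hg by (metis image_eqI)
  next
    fix c assume "c \<in> h ` B"
    then obtain x where "x \<in> B" "c = h x" by blast
    then show "c \<in> {0..1} \<inter> g' -` B" using that gh[of x] h_in[of x] unfolding g'_def by auto
  qed
  have meas: "h ` B \<in> sets borel" "emeasure lborel (h ` B) = emeasure \<mu> B"
    if "B \<in> sets borel" "B \<subseteq> {0..1}" for B
  proof -
    show "h ` B \<in> sets borel"
      unfolding img[OF that(2), symmetric] using measurable_sets_borel[OF g' that(1)] by auto
    show "emeasure lborel (h ` B) = emeasure \<mu> B"
      unfolding img[OF that(2), symmetric] using \<nu>[OF that(1)] \<open>\<nu> = \<mu>\<close> by simp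
  qed
  let ?E = "range (point F)"
  have E: "?E \<in> sets borel" "?E \<subseteq> {0..1}" using range_point_borel[OF fin] point_in[of F] by auto
  have "{z. point F z \<in> ?E} = space coin" by auto
  then have "measure \<mu> ?E = 1" using \<mu>[OF E(1)] C.prob_space by simp
  then have e1: "emeasure lborel (h ` ?E) = 1"
    using meas(2)[OF E] by (simp add: R.emeasure_eq_measure)
  have sub: "h ` ?E \<subseteq> {0..1}" using E(2) h_img by blast
  have "emeasure lborel ({0..1} - h ` ?E) = emeasure lborel {0..1::real} - emeasure lborel (h ` ?E)"
    by (rule emeasure_Diff) (use e1 meas(1)[OF E] sub in auto)
  then have "emeasure lborel ({0..1} - h ` ?E) = 0" using e1 by simp
  then have "{0..1} - h ` ?E \<in> null_sets lborel" using meas(1)[OF E] by (intro null_setsI) auto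
  then have full: "full_measure (h ` ?E)"
    unfolding full_measure_def using sub by (auto intro: null_sets_completionI)
  have pos: "emeasure lebesgue (h ` B) > 0"
    if "compact B" "B \<subseteq> {0..1}" "point F ` ones_block n \<subseteq> B" for n B
  proof -
    have B: "B \<in> sets borel" using that(1) by (intro borel_closed compact_imp_closed)
    have "measure \<mu> B \<ge> measure coin (ones_block n)" by (rule mono) (use B that(3) in auto)
    then have "emeasure \<mu> B > 0" using coin_ones_block[of n] by (simp add: R.emeasure_eq_measure)
    moreover have "emeasure lebesgue (h ` B) = emeasure lborel (h ` B)"
      using meas(1)[OF B that(2)] by (simp add: emeasure_completion)
    ultimately show ?thesis using meas(2)[OF B that(2)] by simp
  qed
  show ?thesis by (rule that[OF g full]) (rule pos)
qed

subsection \<open>Transfer to conjugate maps\<close>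

lemma liminf_zeroI:
  fixes u :: "nat \<Rightarrow> real"
  assumes "\<And>n. 0 \<le> u n" "\<And>e N. e > 0 \<Longrightarrow> \<exists>n\<ge>N. u n < e"
  shows "liminf (\<lambda>n. ereal (u n)) = 0"
proof (rule antisym)
  show "0 \<le> liminf (\<lambda>n. ereal (u n))" by (rule Liminf_bounded) (use assms(1) in auto)
  show "liminf (\<lambda>n. ereal (u n)) \<le> 0"
  proof (rule ccontr)
    assume "\<not> liminf (\<lambda>n. ereal (u n)) \<le> 0"
    then obtain e where e: "0 < ereal e" "ereal e < liminf (\<lambda>n. ereal (u n))"
      using ereal_dense2[of 0] by (auto simp: not_le)
    then have "eventually (\<lambda>n. ereal (u n) > ereal e) sequentially" by (intro less_LiminfD)
    then obtain N where "\<And>n. n \<ge> N \<Longrightarrow> u n > e" unfolding eventually_sequentially by auto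
    then show False using assms(2)[of e N] e(1) by force
  qed
qed

lemma finite_pair_image: "finite {f i j | i j. i < (d::nat) \<and> j < d \<and> P i j}"
proof -
  have "{f i j | i j. i < d \<and> j < d \<and> P i j} \<subseteq> (\<lambda>(i, j). f i j) ` ({..<d} \<times> {..<d})" by auto
  then show ?thesis by (rule finite_subset) simp
qed

lemma prox_tuple_proximal:
  assumes "prox_tuple f d x" "d \<ge> 2"
  shows "proximal f d x"
  unfolding proximal_def
proof (rule liminf_zeroI)
  let ?A = "\<lambda>n. {\<bar>(f ^^ n) (x i) - (f ^^ n) (x j)\<bar> | i j. i < d \<and> j < d}"
  have fin: "finite (?A n)" for n
    using finite_pair_image[of "\<lambda>i j. \<bar>(f ^^ n) (x i) - (f ^^ n) (x j)\<bar>" d "\<lambda>_ _. True"] by simp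
  have zero: "\<bar>(f ^^ n) (x 0) - (f ^^ n) (x 0)\<bar> \<in> ?A n" for n
    using assms(2) by (intro CollectI exI[of _ 0]) simp
  show "0 \<le> Max (?A n)" for n using Max_ge[OF fin zero] by simp
  fix e :: real and N assume "e > 0"
  then obtain n where n: "n \<ge> N" "\<forall>i<d. \<forall>j<d. \<bar>(f ^^ n) (x i) - (f ^^ n) (x j)\<bar> < e"
    using assms(1) unfolding prox_tuple_def by metis
  have "Max (?A n) \<in> ?A n" by (rule Max_in[OF fin]) (use zero in blast)
  then have "Max (?A n) < e" using n(2) by force
  then show "\<exists>n\<ge>N. Max (?A n) < e" using n(1) by blast
qed

text \<open>Distances of at least \<open>\<delta>'\<close> infinitely often bound the upper limit
  only weakly from below; the gap between \<open>\<delta>\<close> and \<open>\<delta>'\<close>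
  supplies the strict inequality.\<close>

lemma sep_tuple_separated:
  assumes "sep_tuple f \<delta>' d x" "d \<ge> 2" "\<delta> < \<delta>'"
  shows "separated f \<delta> d x"
  unfolding separated_def
proof (rule ccontr)
  let ?A = "\<lambda>n. {\<bar>(f ^^ n) (x i) - (f ^^ n) (x j)\<bar> | i j. i < d \<and> j < d \<and> i \<noteq> j}"
  assume "\<not> ereal \<delta> < limsup (\<lambda>n. ereal (Min (?A n)))"
  then have "limsup (\<lambda>n. ereal (Min (?A n))) < ereal \<delta>'"
    using assms(3) by (simp add: not_less order.strict_trans1)
  then have "eventually (\<lambda>n. ereal (Min (?A n)) < ereal \<delta>') sequentially" by (rule Limsup_lessD)
  then obtain N where N: "\<And>n. n \<ge> N \<Longrightarrow> Min (?A n) < \<delta>'" unfolding eventually_sequentially by auto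
  obtain n where n: "n \<ge> N" "\<forall>i<d. \<forall>j<d. i \<noteq> j \<longrightarrow> \<delta>' \<le> \<bar>(f ^^ n) (x i) - (f ^^ n) (x j)\<bar>"
    using assms(1) unfolding sep_tuple_def by metis
  have "\<bar>(f ^^ n) (x 0) - (f ^^ n) (x 1)\<bar> \<in> ?A n" using assms(2) by force
  then have "Min (?A n) \<in> ?A n" by (intro Min_in finite_pair_image) blast
  then have "\<delta>' \<le> Min (?A n)" using n(2) by force
  then show False using N[OF n(1)] by simp
qed

lemma not_li_yorke_pair_distal:
  assumes "\<delta> > 0" "\<And>n. n \<ge> N \<Longrightarrow> \<delta> \<le> \<bar>(f ^^ n) a - (f ^^ n) b\<bar>"
  shows "\<not> li_yorke_pair f a b"
proof
  let ?x = "\<lambda>i::nat. if i = 0 then a else b"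
  let ?A = "\<lambda>n. {\<bar>(f ^^ n) (?x i) - (f ^^ n) (?x j)\<bar> | i j. i < (2::nat) \<and> j < 2}"
  assume "li_yorke_pair f a b"
  then have "liminf (\<lambda>n. ereal (Max (?A n))) = 0"
    unfolding li_yorke_pair_def li_yorke_def delta_li_yorke_def proximal_def by blast
  moreover have ge: "\<delta> \<le> Max (?A n)" if "n \<ge> N" for n
  proof -
    have "finite (?A n)"
      using finite_pair_image[of "\<lambda>i j. \<bar>(f ^^ n) (?x i) - (f ^^ n) (?x j)\<bar>" 2 "\<lambda>_ _. True"] by simp
    moreover have "\<bar>(f ^^ n) (?x 0) - (f ^^ n) (?x 1)\<bar> \<in> ?A n" by force
    ultimately have "\<bar>(f ^^ n) (?x 0) - (f ^^ n) (?x 1)\<bar> \<le> Max (?A n)" by (rule Max_ge)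
    then show ?thesis using assms(2)[OF that] by simp
  qed
  have "ereal \<delta> \<le> liminf (\<lambda>n. ereal (Max (?A n)))"
    by (intro Liminf_bounded eventually_sequentiallyI[of N]) (simp only: ereal_less_eq ge)
  ultimately show False using assms(1) by simp
qed

text \<open>On the diagonal separation fails: the indices 0 and 1 remain distinct, and their
  distance is 0 at all times. This covers equal points in \<open>K\<close>.\<close>

lemma not_li_yorke_pair_refl: "\<not> li_yorke_pair f a a"
proof
  let ?x = "\<lambda>i::nat. if i = 0 then a else a"
  let ?A = "\<lambda>n. {\<bar>(f ^^ n) (?x i) - (f ^^ n) (?x j)\<bar> | i j. i < (2::nat) \<and> j < 2 \<and> i \<noteq> j}"
  assume "li_yorke_pair f a a"
  then obtain \<delta> where \<delta>: "\<delta> > 0" "ereal \<delta> < limsup (\<lambda>n. ereal (Min (?A n)))"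
    unfolding li_yorke_pair_def li_yorke_def delta_li_yorke_def separated_def by blast
  have "?A n = {0}" for n
  proof -
    have "0 \<in> ?A n" by (simp, rule exI[of _ 0], simp, rule exI[of _ 1], simp)
    then show ?thesis by auto
  qed
  then have "limsup (\<lambda>n. ereal (Min (?A n))) = 0" by (simp add: Limsup_const)
  then show False using \<delta> by simp
qed

lemma omega_limit_iff: "y \<in> omega_limit x f \<longleftrightarrow> (\<forall>e>0. \<forall>N. \<exists>n\<ge>N. \<bar>(f ^^ n) x - y\<bar> < e)"
proof
  assume "y \<in> omega_limit x f"
  then obtain r where r: "strict_mono r" "(\<lambda>n. (f ^^ r n) x) \<longlonglongrightarrow> y" unfolding omega_limit_def by blast
  show "\<forall>e>0. \<forall>N. \<exists>n\<ge>N. \<bar>(f ^^ n) x - y\<bar> < e"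
  proof (intro allI impI)
    fix e :: real and N :: nat assume "e > 0"
    then obtain M where M: "\<And>n. n \<ge> M \<Longrightarrow> \<bar>(f ^^ r n) x - y\<bar> < e"
      using LIMSEQ_D[OF r(2)] by (metis real_norm_def)
    have "max M N \<le> r (max M N)" by (rule seq_suble[OF r(1)])
    then show "\<exists>n\<ge>N. \<bar>(f ^^ n) x - y\<bar> < e" using M[of "max M N"] by (intro exI[of _ "r (max M N)"]) auto
  qed
next
  assume *: "\<forall>e>0. \<forall>N. \<exists>n\<ge>N. \<bar>(f ^^ n) x - y\<bar> < e"
  have "\<exists>r. \<forall>n. \<bar>(f ^^ r n) x - y\<bar> < inverse (real (Suc n)) \<and> r n < r (Suc n)"
  proof (rule dependent_nat_choice)
    show "\<exists>k. \<bar>(f ^^ k) x - y\<bar> < inverse (real (Suc 0))" using *[rule_format, of 1 0] by auto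
    fix k n
    show "\<exists>m. \<bar>(f ^^ m) x - y\<bar> < inverse (real (Suc (Suc n))) \<and> k < m"
      using *[rule_format, of "inverse (real (Suc (Suc n)))" "Suc k"] by (auto simp: Suc_le_eq)
  qed
  then obtain r where r: "\<And>n. \<bar>(f ^^ r n) x - y\<bar> < inverse (real (Suc n))" "\<And>n. r n < r (Suc n)" by blast
  have "(\<lambda>n. (f ^^ r n) x - y) \<longlonglongrightarrow> 0"
    by (rule Lim_null_comparison[OF _ LIMSEQ_inverse_real_of_nat])
       (use r(1) in \<open>auto simp: less_imp_le simp del: of_nat_Suc\<close>)
  then have "(\<lambda>n. (f ^^ r n) x) \<longlonglongrightarrow> y" by (rule LIM_zero_cancel)
  moreover have "strict_mono r" using r(2) by (rule strict_monoI_Suc)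
  ultimately show "y \<in> omega_limit x f" unfolding omega_limit_def by blast
qed

lemma omega_limit_subset:
  assumes "closed B" "\<And>n. n \<ge> N \<Longrightarrow> (f ^^ n) x \<in> B"
  shows "omega_limit x f \<subseteq> B"
proof
  fix y assume "y \<in> omega_limit x f"
  then have y: "\<forall>e>0. \<forall>N. \<exists>n\<ge>N. \<bar>(f ^^ n) x - y\<bar> < e" unfolding omega_limit_iff .
  have "\<exists>b\<in>B. dist b y < e" if "e > 0" for e
    using y[rule_format, OF that, of N] assms(2) unfolding dist_real_def by blast
  then have "y \<in> closure B" unfolding closure_approachable by blast
  then show "y \<in> B" using assms(1) by simp
qed

section \<open>Conjugates of the tent map by homeomorphisms of the unit interval\<close>

abbreviation unit_homeo :: "(real \<Rightarrow> real) \<Rightarrow> (real \<Rightarrow> real) \<Rightarrow> bool" where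
  "unit_homeo \<equiv> homeomorphism {0..1} {0..1}"

definition tent_conj :: "(real \<Rightarrow> real) \<Rightarrow> (real \<Rightarrow> real) \<Rightarrow> real \<Rightarrow> real" where
  "tent_conj h h' x = h (tent (h' x))"

lemma unit_homeoD:
  assumes "unit_homeo h h'"
  shows "x \<in> {0..1} \<Longrightarrow> h x \<in> {0..1}" "x \<in> {0..1} \<Longrightarrow> h' x \<in> {0..1}"
    "x \<in> {0..1} \<Longrightarrow> h' (h x) = x" "x \<in> {0..1} \<Longrightarrow> h (h' x) = x"
    "continuous_on {0..1} h" "continuous_on {0..1} h'"
  using assms unfolding homeomorphism_def by blast+

lemma tent_conj_pow:
  assumes "unit_homeo h h'" "x \<in> {0..1}"
  shows "(tent_conj h h' ^^ n) (h x) = h ((tent ^^ n) x)"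
proof (induction n)
  case (Suc n)
  then show ?case
    using unit_homeoD(3)[OF assms(1) tent_pow_in[OF assms(2), of n]] by (simp add: tent_conj_def)
qed simp

lemma interval_map_tent_conj:
  assumes "unit_homeo h h'"
  shows "interval_map (tent_conj h h')"
  unfolding interval_map_def
proof
  note h = unit_homeoD[OF assms]
  have 1: "continuous_on {0..1} (\<lambda>x. tent (h' x))"
    by (rule continuous_on_compose2[OF continuous_on_tent[of UNIV] h(6)]) simp
  show "continuous_on {0..1} (tent_conj h h')" unfolding tent_conj_def
    by (rule continuous_on_compose2[OF h(5) 1]) (use h(2) tent_in in blast)
  show "tent_conj h h' ` {0..1} \<subseteq> {0..1}" unfolding tent_conj_def using h(1,2) tent_in by blast
qed

lemma top_conjugate_tent_conj:
  assumes "unit_homeo h h'" "unit_homeo k k'"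
  shows "top_conjugate (tent_conj h h') (tent_conj k k')"
  unfolding top_conjugate_def
proof (intro exI conjI ballI)
  show "unit_homeo (k \<circ> h') (h \<circ> k')"
    by (rule homeomorphism_compose[OF homeomorphism_symD[OF assms(1)] assms(2)])
  fix x :: real assume x: "x \<in> {0..1}"
  note h = unit_homeoD[OF assms(1)] and k = unit_homeoD[OF assms(2)]
  have "tent (h' x) \<in> {0..1}" by (rule tent_in[OF h(2)[OF x]])
  then show "(k \<circ> h') (tent_conj h h' x) = tent_conj k k' ((k \<circ> h') x)"
    using h(3) k(3)[OF h(2)[OF x]] by (simp only: tent_conj_def comp_apply)
qed

lemma unit_homeo_modulus:
  assumes "unit_homeo h h'" "e > 0"
  obtains d where "d > 0"
    "\<And>x y. x \<in> {0..1} \<Longrightarrow> y \<in> {0..1} \<Longrightarrow> \<bar>x - y\<bar> < d \<Longrightarrow> \<bar>h x - h y\<bar> < e"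
proof -
  have "uniformly_continuous_on {0..1} h"
    by (rule compact_uniformly_continuous[OF unit_homeoD(5)[OF assms(1)] compact_Icc])
  then obtain d where "d > 0" "\<forall>x\<in>{0..1}. \<forall>x'\<in>{0..1}. dist x' x < d \<longrightarrow> dist (h x') (h x) < e"
    using assms(2) unfolding uniformly_continuous_on_def by blast
  then show ?thesis using that[of d] unfolding dist_real_def by blast
qed

text \<open>Uniform continuity of the inverse, contraposed. The bound \<open>\<eta>\<close> does not
  depend on the points, which keeps separation constants uniform over all tuples.\<close>

lemma unit_homeo_modulus_inv:
  assumes "unit_homeo h h'" "\<delta> > 0"
  obtains \<eta> where "\<eta> > 0"
    "\<And>x y. x \<in> {0..1} \<Longrightarrow> y \<in> {0..1} \<Longrightarrow> \<delta> \<le> \<bar>x - y\<bar> \<Longrightarrow> \<eta> \<le> \<bar>h x - h y\<bar>"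
proof -
  obtain \<eta> where \<eta>: "\<eta> > 0"
    "\<And>x y. x \<in> {0..1} \<Longrightarrow> y \<in> {0..1} \<Longrightarrow> \<bar>x - y\<bar> < \<eta> \<Longrightarrow> \<bar>h' x - h' y\<bar> < \<delta>"
    using unit_homeo_modulus[OF homeomorphism_symD[OF assms(1)] assms(2)] by metis
  have "\<eta> \<le> \<bar>h x - h y\<bar>" if "x \<in> {0..1}" "y \<in> {0..1}" "\<delta> \<le> \<bar>x - y\<bar>" for x y
  proof (rule ccontr)
    note h = unit_homeoD[OF assms(1)]
    assume "\<not> \<eta> \<le> \<bar>h x - h y\<bar>"
    then have "\<bar>h' (h x) - h' (h y)\<bar> < \<delta>" by (intro \<eta>(2) h(1) that(1,2)) simp
    then show False using h(3)[OF that(1)] h(3)[OF that(2)] that(3) by simp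
  qed
  with \<eta>(1) show ?thesis by (rule that)
qed

lemma prox_tuple_conj:
  assumes h: "unit_homeo h h'" and p: "prox_tuple tent d x" and x: "\<And>i. x i \<in> {0..1}"
  shows "prox_tuple (tent_conj h h') d (\<lambda>i. h (x i))"
  unfolding prox_tuple_def tent_conj_pow[OF h x]
proof (intro allI impI)
  fix e :: real and N assume "e > 0"
  then obtain e' where e': "e' > 0"
    "\<And>x y. x \<in> {0..1} \<Longrightarrow> y \<in> {0..1} \<Longrightarrow> \<bar>x - y\<bar> < e' \<Longrightarrow> \<bar>h x - h y\<bar> < e"
    using unit_homeo_modulus[OF h] by metis
  obtain n where n: "n \<ge> N" "\<forall>i<d. \<forall>j<d. \<bar>(tent ^^ n) (x i) - (tent ^^ n) (x j)\<bar> < e'"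
    using p e'(1) unfolding prox_tuple_def by metis
  show "\<exists>n\<ge>N. \<forall>i<d. \<forall>j<d. \<bar>h ((tent ^^ n) (x i)) - h ((tent ^^ n) (x j))\<bar> < e"
    by (intro exI[of _ n] conjI allI impI n(1) e'(2) tent_pow_in x) (use n(2) in simp)
qed

lemma sep_tuple_conj:
  assumes h: "unit_homeo h h'" and s: "sep_tuple tent \<delta> d x" and x: "\<And>i. x i \<in> {0..1}"
    and \<eta>: "\<And>x y. x \<in> {0..1} \<Longrightarrow> y \<in> {0..1} \<Longrightarrow> \<delta> \<le> \<bar>x - y\<bar> \<Longrightarrow> \<eta> \<le> \<bar>h x - h y\<bar>"
  shows "sep_tuple (tent_conj h h') \<eta> d (\<lambda>i. h (x i))"
  unfolding sep_tuple_def tent_conj_pow[OF h x]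
proof
  fix N
  obtain n where n: "n \<ge> N" "\<forall>i<d. \<forall>j<d. i \<noteq> j \<longrightarrow> \<delta> \<le> \<bar>(tent ^^ n) (x i) - (tent ^^ n) (x j)\<bar>"
    using s unfolding sep_tuple_def by metis
  show "\<exists>n\<ge>N. \<forall>i<d. \<forall>j<d. i \<noteq> j \<longrightarrow> \<eta> \<le> \<bar>h ((tent ^^ n) (x i)) - h ((tent ^^ n) (x j))\<bar>"
    by (intro exI[of _ n] conjI allI impI n(1) \<eta> tent_pow_in x) (use n(2) in simp)
qed

lemma block_map_li_yorke:
  assumes h: "unit_homeo h h'" and F: "block_map F G" "inj (\<lambda>n::nat. pt (G (pad (u n))))"
  shows "\<exists>\<delta>::nat \<Rightarrow> real. (\<forall>d. \<delta> d > 0) \<and>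
    (\<forall>d\<ge>2. \<forall>x. (\<forall>i<d. x i \<in> h ` range (point F)) \<and> inj_on x {..<d} \<longrightarrow>
      prox_tuple (tent_conj h h') d x \<and> sep_tuple (tent_conj h h') (\<delta> d) d x)"
proof -
  have "\<exists>\<eta>>0. \<forall>x. (\<forall>i<d. x i \<in> h ` range (point F)) \<and> inj_on x {..<d} \<longrightarrow>
      prox_tuple (tent_conj h h') d x \<and> sep_tuple (tent_conj h h') \<eta> d x" for d
  proof -
    obtain \<delta> where \<delta>: "\<delta> > 0"
      "\<And>z. inj_on z {..<d} \<Longrightarrow> sep_tuple tent \<delta> d (\<lambda>i. point F (z i))"
      using block_map_sep[OF F, of d] by blast
    obtain \<eta> where \<eta>: "\<eta> > 0"
      "\<And>x y. x \<in> {0..1} \<Longrightarrow> y \<in> {0..1} \<Longrightarrow> \<delta> \<le> \<bar>x - y\<bar> \<Longrightarrow> \<eta> \<le> \<bar>h x - h y\<bar>"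
      using unit_homeo_modulus_inv[OF h \<delta>(1)] by metis
    have "prox_tuple (tent_conj h h') d x \<and> sep_tuple (tent_conj h h') \<eta> d x"
      if x: "\<forall>i<d. x i \<in> h ` range (point F)" "inj_on x {..<d}" for x
    proof -
      \<comment> \<open>The guard allows an arbitrary parameter at indices from \<open>d\<close> on,
        which the tuple conditions do not inspect.\<close>
      have "\<forall>i. \<exists>z. i < d \<longrightarrow> x i = h (point F z)" using x(1) by blast
      then obtain z where z: "\<And>i. i < d \<Longrightarrow> x i = h (point F (z i))" by metis
      have "inj_on z {..<d}"
        using x(2) z unfolding inj_on_def by (metis lessThan_iff)
      then have "sep_tuple (tent_conj h h') \<eta> d (\<lambda>i. h (point F (z i)))"
        by (intro sep_tuple_conj[OF h \<delta>(2)] point_in \<eta>(2))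
      moreover have "prox_tuple (tent_conj h h') d (\<lambda>i. h (point F (z i)))"
        by (intro prox_tuple_conj[OF h block_map_prox[OF F(1)]] point_in)
      ultimately show ?thesis unfolding prox_tuple_def sep_tuple_def using z by simp
    qed
    then show ?thesis using \<eta>(1) by blast
  qed
  then show ?thesis by metis
qed

lemma omega_limit_conj:
  assumes h: "unit_homeo h h'" and x: "x \<in> {0..1}" and a: "a \<in> {0..1}"
    and "\<And>e N. e > 0 \<Longrightarrow> \<exists>n\<ge>N. \<bar>(tent ^^ n) x - a\<bar> < e"
  shows "h a \<in> omega_limit (h x) (tent_conj h h')"
  unfolding omega_limit_iff tent_conj_pow[OF h x]
proof (intro allI impI)
  fix e :: real and N :: nat assume "e > 0"
  then obtain e' where e': "e' > 0"
    "\<And>x y. x \<in> {0..1} \<Longrightarrow> y \<in> {0..1} \<Longrightarrow> \<bar>x - y\<bar> < e' \<Longrightarrow> \<bar>h x - h y\<bar> < e"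
    using unit_homeo_modulus[OF h] by metis
  obtain n where n: "n \<ge> N" "\<bar>(tent ^^ n) x - a\<bar> < e'" using assms(4)[OF e'(1)] by blast
  show "\<exists>n\<ge>N. \<bar>h ((tent ^^ n) x) - h a\<bar> < e"
    by (intro exI[of _ n] conjI n e'(2) tent_pow_in x a)
qed

lemma omega_limit_dense_seq:
  assumes h: "unit_homeo h h'"
  shows "omega_limit (h (point dense_seq z)) (tent_conj h h') = {0..1}"
proof
  note H = unit_homeoD[OF h]
  show "omega_limit (h (point dense_seq z)) (tent_conj h h') \<subseteq> {0..1}"
    by (rule omega_limit_subset[OF closed_atLeastAtMost, of 0])
       (simp only: tent_conj_pow[OF h point_in] H(1)[OF tent_pow_in[OF point_in]])
  show "{0..1} \<subseteq> omega_limit (h (point dense_seq z)) (tent_conj h h')"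
  proof
    fix y :: real assume y: "y \<in> {0..1}"
    have "h (h' y) \<in> omega_limit (h (point dense_seq z)) (tent_conj h h')"
      by (rule omega_limit_conj[OF h point_in H(2)[OF y] dense_orbit[OF H(2)[OF y]]])
    then show "y \<in> omega_limit (h (point dense_seq z)) (tent_conj h h')" using H(4)[OF y] by simp
  qed
qed

lemma compact_min_tent: "compact min_tent"
  using closed_min_tent min_tent_subset by (meson bounded_closed_interval bounded_subset compact_eq_bounded_closed)

lemma compact_image_min_tent:
  assumes h: "unit_homeo h h'"
  shows "compact (h ` min_tent)"
  by (rule compact_continuous_image[OF continuous_on_subset[OF unit_homeoD(5)[OF h] min_tent_subset] compact_min_tent])

lemma omega_limit_min_seq:
  assumes h: "unit_homeo h h'"
  shows "omega_limit (h (point min_seq z)) (tent_conj h h') = h ` min_tent"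
proof
  show "omega_limit (h (point min_seq z)) (tent_conj h h') \<subseteq> h ` min_tent"
    by (rule omega_limit_subset[OF compact_imp_closed[OF compact_image_min_tent[OF h]],
          of "length (head_word z)"])
       (simp only: tent_conj_pow[OF h point_in] imageI point_min_seq_eventually)
  show "h ` min_tent \<subseteq> omega_limit (h (point min_seq z)) (tent_conj h h')"
    using omega_limit_conj[OF h point_in _ point_min_seq_dense] min_tent_subset by blast
qed

lemma minimal_set_image:
  assumes h: "unit_homeo h h'"
  shows "minimal_set (tent_conj h h') (h ` min_tent)"
  unfolding minimal_set_def
proof (intro conjI allI impI)
  note H = unit_homeoD[OF h]
  show "h ` min_tent \<noteq> {}" using min_start_in by blast
  show "closed (h ` min_tent)" by (rule compact_imp_closed[OF compact_image_min_tent[OF h]])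
  show "h ` min_tent \<subseteq> {0..1}" using H(1) min_tent_subset by blast
  have step: "tent_conj h h' (h a) = h (tent a)" if "a \<in> min_tent" for a
    using H(3)[of a] that min_tent_subset unfolding tent_conj_def by auto
  show "tent_conj h h' ` h ` min_tent \<subseteq> h ` min_tent"
    using step tent_min_tent by auto
  fix B assume B: "B \<noteq> {} \<and> closed B \<and> B \<subseteq> h ` min_tent \<and> tent_conj h h' ` B \<subseteq> B"
  \<comment> \<open>The invariant set is pulled back by \<open>h\<close>, so that minimality of
    \<open>min_tent\<close> applies to it.\<close>
  define C where "C = {a \<in> min_tent. h a \<in> B}"
  have "closed (min_tent \<inter> h -` B)"
    by (rule continuous_closed_preimage[OF continuous_on_subset[OF H(5) min_tent_subset] closed_min_tent])
       (use B in blast)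
  then have "closed C" unfolding C_def by (simp add: vimage_def Int_def)
  moreover have "C \<noteq> {}" "C \<subseteq> min_tent" unfolding C_def using B by auto
  moreover have "tent ` C \<subseteq> C"
  proof
    fix b assume "b \<in> tent ` C"
    then obtain a where a: "a \<in> min_tent" "h a \<in> B" "b = tent a" unfolding C_def by blast
    have "tent_conj h h' (h a) \<in> B" using B a(2) by blast
    then show "b \<in> C" unfolding C_def using a step[OF a(1)] tent_min_tent by auto
  qed
  ultimately have "C = min_tent" by (intro min_tent_sub_eq)
  then have "h ` min_tent \<subseteq> B" unfolding C_def by blast
  then show "B = h ` min_tent" using B by blast
qed

lemma cantor_set_image:
  assumes h: "unit_homeo h h'"
  shows "cantor_set (h ` min_tent)"
  unfolding cantor_set_def
proof (intro conjI ballI)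
  note H = unit_homeoD[OF h]
  show "h ` min_tent \<noteq> {}" using min_start_in by blast
  show "compact (h ` min_tent)" by (rule compact_image_min_tent[OF h])
next
  note H = unit_homeoD[OF h]
  fix y assume "y \<in> h ` min_tent"
  then obtain a where a: "a \<in> min_tent" "y = h a" by blast
  show "y islimpt h ` min_tent"
    unfolding islimpt_approachable dist_real_def
  proof (intro allI impI)
    fix e :: real assume "e > 0"
    then obtain e' where e': "e' > 0"
      "\<And>x y. x \<in> {0..1} \<Longrightarrow> y \<in> {0..1} \<Longrightarrow> \<bar>x - y\<bar> < e' \<Longrightarrow> \<bar>h x - h y\<bar> < e"
      using unit_homeo_modulus[OF h] by metis
    obtain b where b: "b \<in> min_tent" "b \<noteq> a" "\<bar>b - a\<bar> < e'"
      using min_tent_islimpt[OF a(1)] e'(1) unfolding islimpt_approachable dist_real_def by blast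
    have ab: "a \<in> {0..1}" "b \<in> {0..1}" using a b min_tent_subset by blast+
    have "h b \<noteq> h a" using H(3)[OF ab(1)] H(3)[OF ab(2)] b(2) by metis
    then show "\<exists>x'\<in>h ` min_tent. x' \<noteq> y \<and> \<bar>x' - y\<bar> < e"
      using b e'(2)[OF ab(2,1)] unfolding a(2) by blast
  qed
next
  fix y assume "y \<in> h ` min_tent"
  then obtain a where a: "a \<in> min_tent" "y = h a" by blast
  \<comment> \<open>Two points of one component would span an interval inside
    \<open>min_tent\<close>. The component is found to be trivial before conjugation and then
    carried over by \<open>h\<close>.\<close>
  let ?C = "connected_component_set min_tent a"
  have C: "connected ?C" "?C \<subseteq> min_tent" "a \<in> ?C"
    using a connected_component_subset[of min_tent a] by (auto simp: connected_connected_component)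
  have "b = a" if "b \<in> ?C" for b
  proof (rule ccontr)
    assume "b \<noteq> a"
    then have "min a b < max a b" by auto
    moreover have "{min a b..max a b} \<subseteq> ?C"
      by (rule connected_contains_Icc[OF C(1)]) (use C(3) that in \<open>auto simp: min_def max_def\<close>)
    ultimately show False using min_tent_no_interval C(2) by blast
  qed
  then have "?C = {a}" using C(3) by blast
  moreover have "homeomorphism min_tent (h ` min_tent) h h'"
    by (rule homeomorphism_of_subsets[OF h min_tent_subset order.refl refl])
  ultimately show "connected_component_set (h ` min_tent) y = {y}"
    using connected_component_set_homeomorphism[of min_tent "h ` min_tent" h h' a] a by simp
qed

lemma toeplitz_not_li_yorke:
  assumes h: "unit_homeo h h'" and x: "x \<in> h ` range (point toeplitz_seq)" "y \<in> h ` range (point toeplitz_seq)"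
  shows "\<not> li_yorke_pair (tent_conj h h') x y"
proof -
  obtain z z' where z: "x = h (point toeplitz_seq z)" "y = h (point toeplitz_seq z')" using x by blast
  show ?thesis
  proof (cases "z = z'")
    case True
    then show ?thesis using not_li_yorke_pair_refl z by simp
  next
    case False
    then obtain \<delta> N where \<delta>: "\<delta> > 0" "\<And>n. n \<ge> N \<Longrightarrow>
        \<delta> \<le> \<bar>(tent ^^ n) (point toeplitz_seq z) - (tent ^^ n) (point toeplitz_seq z')\<bar>"
      using toeplitz_distal by metis
    obtain \<eta> where \<eta>: "\<eta> > 0"
      "\<And>x y. x \<in> {0..1} \<Longrightarrow> y \<in> {0..1} \<Longrightarrow> \<delta> \<le> \<bar>x - y\<bar> \<Longrightarrow> \<eta> \<le> \<bar>h x - h y\<bar>"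
      using unit_homeo_modulus_inv[OF h \<delta>(1)] by metis
    show ?thesis
    proof (rule not_li_yorke_pair_distal[OF \<eta>(1), of N])
      fix n assume "n \<ge> N"
      then show "\<eta> \<le> \<bar>(tent_conj h h' ^^ n) x - (tent_conj h h' ^^ n) y\<bar>"
        unfolding z tent_conj_pow[OF h point_in] by (intro \<eta>(2) tent_pow_in point_in \<delta>(2))
    qed
  qed
qed

text \<open>A related pair has a coordinate outside \<open>K\<close>, hence lies in one of two
  strips over a Borel null set \<open>N\<close>. In the completion a null superset suffices, so
  measurability of \<open>R\<close> is never at issue.\<close>

lemma null_pairs:
  fixes K :: "real set"
  assumes K: "full_measure K" and "\<And>x y. x \<in> K \<Longrightarrow> y \<in> K \<Longrightarrow> \<not> R x y"
  shows "{(x, y). x \<in> {0..1} \<and> y \<in> {0..1} \<and> R x y} \<in> null_sets (completion lborel)"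
proof -
  obtain N where N: "N \<in> null_sets lborel" "{0..1} - K \<subseteq> N"
    using K unfolding full_measure_def null_sets_completion_iff2 by blast
  have "N \<times> (UNIV :: real set) \<in> null_sets (lborel \<Otimes>\<^sub>M lborel)"
    by (rule lborel.times_in_null_sets1[OF N(1)]) simp
  moreover have "(UNIV :: real set) \<times> N \<in> null_sets (lborel \<Otimes>\<^sub>M lborel)"
    by (rule lborel.times_in_null_sets2[OF _ N(1)]) simp
  ultimately have "N \<times> UNIV \<union> UNIV \<times> N \<in> null_sets (lborel :: (real \<times> real) measure)"
    unfolding lborel_prod by (rule null_sets.Un)
  moreover have "{(x, y). x \<in> {0..1} \<and> y \<in> {0..1} \<and> R x y} \<subseteq> N \<times> UNIV \<union> UNIV \<times> N"
    using assms(2) N(2) by blast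
  ultimately show ?thesis unfolding null_sets_completion_iff2 by blast
qed

theorem theoremC:
  shows "\<exists>P S T K L M (\<delta>::nat \<Rightarrow> real).
    interval_map P \<and> interval_map S \<and> interval_map T \<and>
    top_conjugate P S \<and> top_conjugate S T \<and> top_conjugate P T \<and>
    (\<forall>d\<ge>2. \<delta> d > 0) \<and>
    full_measure K \<and> full_measure L \<and> full_measure M \<and>
    (\<forall>d\<ge>2. \<forall>x. (\<forall>i<d. x i \<in> L) \<and> inj_on x {..<d} \<longrightarrow> delta_li_yorke S (\<delta> d) d x) \<and>
    (\<forall>d\<ge>2. \<forall>x. (\<forall>i<d. x i \<in> M) \<and> inj_on x {..<d} \<longrightarrow> delta_li_yorke T (\<delta> d) d x) \<and>
    (\<forall>x\<in>L. omega_limit x S = {0..1}) \<and>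
    (\<exists>A. cantor_set A \<and> A \<in> sets lebesgue \<and> emeasure lebesgue A > 0 \<and>
         minimal_set T A \<and> (\<forall>x\<in>M. omega_limit x T = A)) \<and>
    (\<forall>x\<in>K. \<forall>y\<in>K. \<not> li_yorke_pair P x y) \<and>
    {(x, y). x \<in> {0..1} \<and> y \<in> {0..1} \<and> li_yorke_pair P x y} \<in> null_sets (completion lborel)"
proof -
  obtain k k' where k: "unit_homeo k k'" "full_measure (k ` range (point toeplitz_seq))"
    using full_measure_homeomorphism[OF finitary_toeplitz_seq inj_point_toeplitz] by metis
  obtain l l' where l: "unit_homeo l l'" "full_measure (l ` range (point dense_seq))"
    using full_measure_homeomorphism[OF finitary_dense_seq
        block_map_inj_point[OF block_map_dense_seq inj_dense_marks]] by metis
  obtain m m' where m: "unit_homeo m m'" "full_measure (m ` range (point min_seq))"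
    "\<And>n B. compact B \<Longrightarrow> B \<subseteq> {0..1} \<Longrightarrow> point min_seq ` ones_block n \<subseteq> B \<Longrightarrow> emeasure lebesgue (m ` B) > 0"
    using full_measure_homeomorphism[OF finitary_min_seq
        block_map_inj_point[OF block_map_min_seq inj_min_marks]] by metis
  obtain \<delta>1 where \<delta>1: "\<And>d. \<delta>1 d > 0"
    "\<And>d x. d \<ge> 2 \<Longrightarrow> (\<forall>i<d. x i \<in> l ` range (point dense_seq)) \<and> inj_on x {..<d} \<Longrightarrow>
      prox_tuple (tent_conj l l') d x \<and> sep_tuple (tent_conj l l') (\<delta>1 d) d x"
    using block_map_li_yorke[OF l(1) block_map_dense_seq inj_dense_marks] by blast
  obtain \<delta>2 where \<delta>2: "\<And>d. \<delta>2 d > 0"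
    "\<And>d x. d \<ge> 2 \<Longrightarrow> (\<forall>i<d. x i \<in> m ` range (point min_seq)) \<and> inj_on x {..<d} \<Longrightarrow>
      prox_tuple (tent_conj m m') d x \<and> sep_tuple (tent_conj m m') (\<delta>2 d) d x"
    using block_map_li_yorke[OF m(1) block_map_min_seq inj_min_marks] by blast
  \<comment> \<open>One constant for both maps; halving makes it strictly smaller than each of the
    two weak separation bounds.\<close>
  define \<delta> where "\<delta> d = min (\<delta>1 d) (\<delta>2 d) / 2" for d
  have \<delta>: "\<delta> d > 0" "\<delta> d < \<delta>1 d" "\<delta> d < \<delta>2 d" for d
    using \<delta>1(1)[of d] \<delta>2(1)[of d] unfolding \<delta>_def by (auto simp: min_def)
  \<comment> \<open>On the piece whose head word is empty the points are
    \<open>pt (min_seq z)\<close> themselves and lie in \<open>min_tent\<close>. Since that piece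
    has positive probability, so has \<open>min_tent\<close>, and its image has positive Lebesgue
    measure.\<close>
  have "point min_seq ` ones_block (to_nat ([] :: bool list)) \<subseteq> min_tent"
  proof
    fix x assume "x \<in> point min_seq ` ones_block (to_nat ([] :: bool list))"
    then obtain z where "z \<in> ones_block (to_nat ([] :: bool list))" "x = point min_seq z" by blast
    moreover have "override [] s = s" for s by (rule ext) (simp add: override_def)
    ultimately have "x = pt (min_seq z)" by (simp add: point_ones_block)
    then show "x \<in> min_tent" by (simp add: pt_min_seq_in)
  qed
  then have pos: "emeasure lebesgue (m ` min_tent) > 0"
    by (rule m(3)[OF compact_min_tent min_tent_subset])
  have A: "\<exists>A. cantor_set A \<and> A \<in> sets lebesgue \<and> emeasure lebesgue A > 0 \<and>
      minimal_set (tent_conj m m') A \<and>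
      (\<forall>x\<in>m ` range (point min_seq). omega_limit x (tent_conj m m') = A)"
    using cantor_set_image[OF m(1)] pos minimal_set_image[OF m(1)] omega_limit_min_seq[OF m(1)]
      fmeasurableD[OF lmeasurable_compact[OF compact_image_min_tent[OF m(1)]]] by blast
  show ?thesis
  proof (rule exI[of _ "tent_conj k k'"], rule exI[of _ "tent_conj l l'"],
      rule exI[of _ "tent_conj m m'"], rule exI[of _ "k ` range (point toeplitz_seq)"],
      rule exI[of _ "l ` range (point dense_seq)"], rule exI[of _ "m ` range (point min_seq)"],
      rule exI[of _ \<delta>], intro conjI interval_map_tent_conj top_conjugate_tent_conj k l m(1,2) A)
    show "\<forall>d\<ge>2. \<delta> d > 0" using \<delta>(1) by blast
    show "\<forall>d\<ge>2. \<forall>x. (\<forall>i<d. x i \<in> l ` range (point dense_seq)) \<and> inj_on x {..<d} \<longrightarrow>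
        delta_li_yorke (tent_conj l l') (\<delta> d) d x"
      using \<delta>1(2) \<delta>(2) unfolding delta_li_yorke_def by (metis prox_tuple_proximal sep_tuple_separated)
    show "\<forall>d\<ge>2. \<forall>x. (\<forall>i<d. x i \<in> m ` range (point min_seq)) \<and> inj_on x {..<d} \<longrightarrow>
        delta_li_yorke (tent_conj m m') (\<delta> d) d x"
      using \<delta>2(2) \<delta>(3) unfolding delta_li_yorke_def by (metis prox_tuple_proximal sep_tuple_separated)
    show "\<forall>x\<in>l ` range (point dense_seq). omega_limit x (tent_conj l l') = {0..1}"
      using omega_limit_dense_seq[OF l(1)] by blast
    show "\<forall>x\<in>k ` range (point toeplitz_seq). \<forall>y\<in>k ` range (point toeplitz_seq).
        \<not> li_yorke_pair (tent_conj k k') x y"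
      using toeplitz_not_li_yorke[OF k(1)] by blast
    show "{(x, y). x \<in> {0..1} \<and> y \<in> {0..1} \<and> li_yorke_pair (tent_conj k k') x y}
        \<in> null_sets (completion lborel)"
      by (rule null_pairs[OF k(2) toeplitz_not_li_yorke[OF k(1)]])
  qed
qed

end
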